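(* Let $\mathbb{X}$ be a superreflexive Banach space. For every $C>0$ there are $K>0$ and $q>1$ such that if a sequence $(f_n)_{n=1}^\infty$ in $\mathbb{X}$ satisfies $\sum_{n=1}^\infty\|f_n\|^q<\infty$ and \[ \left\|\sum_{n=j}^k f_n\right\|\le C\left\|\sum_{n=j}^k f_n-\sum_{n=k+1}^m f_n\right\|,\qquad 1\le j\le k\le m, \] then $\sum_{n=1}^\infty f_n$ converges in $\mathbb{X}$ and \[ \left\|\sum_{n=1}^\infty f_n\right\|\le K\left(\sum_{n=1}^\infty\|f_n\|^q\right)^{1/q}. \]
   Context: A Banach space is superreflexive if every Banach space finitely representable in it is reflexive; equivalently (Enflo), if it admits an equivalent uniformly convex norm. An empty sum is $0$. *)

theory Defs
  imports "HOL-Analysis.Analysis"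
begin

text \<open>
  A normed space is given as a pair of a linear subspace \<open>V\<close> of some ambient real vector space
  and a function \<open>N\<close> that is a norm on \<open>V\<close>. The values of \<open>N\<close> outside \<open>V\<close> are irrelevant, and
  \<open>N\<close> is unrelated to any norm that the ambient type may carry.
\<close>

definition normed_space_on :: "'v::real_vector set \<Rightarrow> ('v \<Rightarrow> real) \<Rightarrow> bool" where
  "normed_space_on V N \<longleftrightarrow>
     subspace V \<and>
     (\<forall>x\<in>V. 0 \<le> N x \<and> (N x = 0 \<longleftrightarrow> x = 0)) \<and>
     (\<forall>c. \<forall>x\<in>V. N (c *\<^sub>R x) = \<bar>c\<bar> * N x) \<and>
     (\<forall>x\<in>V. \<forall>y\<in>V. N (x + y) \<le> N x + N y)"

definition banach_space_on :: "'v::real_vector set \<Rightarrow> ('v \<Rightarrow> real) \<Rightarrow> bool" where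
  "banach_space_on V N \<longleftrightarrow>
     normed_space_on V N \<and>
     (\<forall>s :: nat \<Rightarrow> 'v.
        (\<forall>n. s n \<in> V) \<and> (\<forall>e>0. \<exists>M. \<forall>m\<ge>M. \<forall>n\<ge>M. N (s m - s n) < e) \<longrightarrow>
        (\<exists>l\<in>V. (\<lambda>n. N (s n - l)) \<longlonglongrightarrow> 0))"

text \<open>
  Functionals on \<open>V\<close> are extended by \<open>0\<close> outside \<open>V\<close>, so that each functional on \<open>V\<close> is
  represented by exactly one function and the dual is closed under pointwise operations.
\<close>

definition dual_on :: "'v::real_vector set \<Rightarrow> ('v \<Rightarrow> real) \<Rightarrow> ('v \<Rightarrow> real) set" where
  "dual_on V N = {\<phi>.
     (\<forall>x\<in>V. \<forall>y\<in>V. \<phi> (x + y) = \<phi> x + \<phi> y) \<and>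
     (\<forall>c. \<forall>x\<in>V. \<phi> (c *\<^sub>R x) = c * \<phi> x) \<and>
     (\<exists>B. \<forall>x\<in>V. \<bar>\<phi> x\<bar> \<le> B * N x) \<and>
     (\<forall>x. x \<notin> V \<longrightarrow> \<phi> x = 0)}"

definition dual_norm_on :: "'v::real_vector set \<Rightarrow> ('v \<Rightarrow> real) \<Rightarrow> ('v \<Rightarrow> real) \<Rightarrow> real" where
  "dual_norm_on V N \<phi> = (SUP x\<in>{x\<in>V. N x \<le> 1}. \<bar>\<phi> x\<bar>)"

text \<open>Reflexivity: the canonical embedding into the bidual is onto.\<close>

definition reflexive_on :: "'v::real_vector set \<Rightarrow> ('v \<Rightarrow> real) \<Rightarrow> bool" where
  "reflexive_on V N \<longleftrightarrow>
     (\<forall>\<Phi> :: ('v \<Rightarrow> real) \<Rightarrow> real.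
        (\<forall>\<phi>\<in>dual_on V N. \<forall>\<psi>\<in>dual_on V N. \<Phi> (\<lambda>x. \<phi> x + \<psi> x) = \<Phi> \<phi> + \<Phi> \<psi>) \<and>
        (\<forall>c. \<forall>\<phi>\<in>dual_on V N. \<Phi> (\<lambda>x. c * \<phi> x) = c * \<Phi> \<phi>) \<and>
        (\<exists>B. \<forall>\<phi>\<in>dual_on V N. \<bar>\<Phi> \<phi>\<bar> \<le> B * dual_norm_on V N \<phi>) \<longrightarrow>
        (\<exists>x\<in>V. \<forall>\<phi>\<in>dual_on V N. \<Phi> \<phi> = \<phi> x))"

text \<open>
  \<open>(V, N)\<close> is finitely representable in the space \<open>'a\<close>: every finite-dimensional subspace
  \<open>span S\<close> of \<open>V\<close> is, for every \<open>\<epsilon> > 0\<close>, \<open>(1 + \<epsilon>)\<close>-isomorphic to a subspace of \<open>'a\<close>. The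
  isomorphism is scaled so that its inverse has norm at most \<open>1\<close>. Only the restriction of \<open>T\<close> to
  \<open>span S\<close> matters; asking for linearity everywhere is no restriction since linear maps extend.
\<close>

definition finitely_representable ::
    "'v::real_vector set \<Rightarrow> ('v \<Rightarrow> real) \<Rightarrow> 'a::real_normed_vector itself \<Rightarrow> bool" where
  "finitely_representable V N _ \<longleftrightarrow>
     (\<forall>S \<epsilon>. finite S \<and> S \<subseteq> V \<and> 0 < \<epsilon> \<longrightarrow>
        (\<exists>T :: 'v \<Rightarrow> 'a. linear T \<and>
           (\<forall>x\<in>span S. N x \<le> norm (T x) \<and> norm (T x) \<le> (1 + \<epsilon>) * N x)))"

text \<open>
  A superreflexive space: every Banach space finitely representable in it is reflexive.

  HOL cannot quantify over all Banach spaces inside a formula, so the spaces range over all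
  pairs \<open>(V, N)\<close> whose underlying vector space \<open>V\<close> is a linear subspace of \<open>\<ell>\<^sub>\<infinity>\<close> (the type
  \<open>nat \<Rightarrow>\<^sub>C real\<close>), with an arbitrary complete norm \<open>N\<close>. Since \<open>\<ell>\<^sub>\<infinity>\<close> has algebraic dimension
  \<open>2\<^bsup>\<aleph>\<^sub>0\<^esup>\<close>, these are, up to isometric isomorphism, precisely the real Banach spaces of
  cardinality at most that of the continuum, among them all separable ones. This loses nothing:
  finite representability passes to closed subspaces, and a Banach space all of whose separable
  closed subspaces are reflexive is itself reflexive (Eberlein and Smulian).
\<close>

definition superreflexive :: "'a::banach itself \<Rightarrow> bool" where
  "superreflexive X \<longleftrightarrow>
     (\<forall>(V :: (nat \<Rightarrow>\<^sub>C real) set) N.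
        banach_space_on V N \<and> finitely_representable V N X \<longrightarrow> reflexive_on V N)"

end

theory Submission
  imports Defs "HOL-Complex_Analysis.Great_Picard" "HOL-Library.Nat_Bijection"
begin

text \<open>
  Call a sequence dominating if it satisfies the inequality of the theorem; dominating sequences are
  closed under passing to consecutive blocks. The heart of the matter is that for some \<open>N\<close> the sum of
  \<open>N\<close> terms of norm at most \<open>1\<close> of a dominating sequence has norm at most \<open>N - 1/2\<close>. Otherwise the
  dyadic averages of near-extremal sequences of length \<open>2\<^sup>n\<close> are dyadic trees of height \<open>n\<close> in the unit
  ball whose siblings are \<open>1/(2C)\<close>-separated. A limit of these trees lives in a separable Banach space
  that is finitely representable in the given one, and no separable reflexive space contains a
  bounded infinite separated tree: its node set is not dentable.

  The gain at the single length \<open>N\<close> gives an upper \<open>q\<close>-estimate as soon as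
  \<open>(N - 1/2) N\<^bsup>-1/q\<^esup> < 1\<close>: cut a finite sequence into \<open>N\<close> blocks of nearly equal
  \<open>\<ell>\<^sub>q\<close>-mass and use induction on the length in each block.
\<close>

section \<open>Sublinear functionals\<close>

text \<open>A deficit of 1/2 that does not grow with the length is what produces trees: if a sum of
  unit-bounded terms falls short of its maximal norm by less than 1/2, so does each of its blocks,
  at all scales at once. In the other direction any gain at one length suffices, since
  \<open>N powr (1 / q)\<close> tends to \<open>N\<close> as \<open>q\<close> decreases to 1 and
  hence exceeds \<open>N - 1/2\<close> for some \<open>q > 1\<close>. The obstacle is the limit of
  trees of growing height. An ultrapower would leave the spaces over which
  \<open>superreflexive\<close> ranges. The limit is therefore built inside the bounded sequences,
  the coordinates being limits of norming functionals; being generated by countably many vectors it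
  is separable, and the argument against an infinite tree uses exactly this, avoiding the points of
  a dense sequence one after the other. Reflexivity enters through a weak limit of a bounded
  sequence, which a generalized limit on the bounded sequences supplies without any weak compactness
  theorem.\<close>

definition sublinear :: "('v::real_vector \<Rightarrow> real) \<Rightarrow> bool" where
  "sublinear p \<longleftrightarrow> (\<forall>x y. p (x + y) \<le> p x + p y) \<and> (\<forall>t x. 0 \<le> t \<longrightarrow> p (t *\<^sub>R x) = t * p x)"

lemma sublinear_add: "sublinear p \<Longrightarrow> p (x + y) \<le> p x + p y"
  and sublinear_scale: "sublinear p \<Longrightarrow> 0 \<le> t \<Longrightarrow> p (t *\<^sub>R x) = t * p x"
  by (auto simp: sublinear_def)

lemma sublinear_zero: "sublinear p \<Longrightarrow> p 0 = 0"
  using sublinear_scale[of p 0 0] by simp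

lemma sublinear_minus: "sublinear p \<Longrightarrow> - p (- x) \<le> p x"
  using sublinear_add[of p x "- x"] sublinear_zero[of p] by simp

lemma sublinear_norm: "sublinear (norm :: 'a::real_normed_vector \<Rightarrow> real)"
  by (auto simp: sublinear_def norm_triangle_ineq)

text \<open>The largest sublinear functional below \<open>p\<close> whose value at
  \<open>- y\<close> is at most \<open>- p y\<close>. A linear functional below it therefore agrees
  with \<open>p\<close> at \<open>y\<close>.\<close>

definition Inf_along :: "('v::real_vector \<Rightarrow> real) \<Rightarrow> 'v \<Rightarrow> 'v \<Rightarrow> real" where
  "Inf_along p y x = (INF t\<in>{0..}. p (x + t *\<^sub>R y) - t * p y)"

text \<open>As \<open>t * p y = p (t *\<^sub>R y)\<close> for \<open>t \<ge> 0\<close>,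
  subadditivity bounds the infimum below by \<open>- p (- x)\<close>. Near-optimal parameters
  \<open>s\<close> for \<open>x\<close> and \<open>t\<close> for \<open>z\<close> combine to
  \<open>s + t\<close> for \<open>x + z\<close>. The choice \<open>t = 1\<close> gives the value at
  \<open>- y\<close>.\<close>

lemma
  assumes p: "sublinear p"
  shows sublinear_Inf_along: "sublinear (Inf_along p y)"
    and Inf_along_le: "Inf_along p y x \<le> p x"
    and Inf_along_minus: "Inf_along p y (- y) \<le> - p y"
proof -
  define q where q_eq: "q = Inf_along p y"
  have q_def: "q x = (INF t\<in>{0..}. p (x + t *\<^sub>R y) - t * p y)" for x
    by (simp add: q_eq Inf_along_def)
  have lower: "- p (- x) \<le> p (x + t *\<^sub>R y) - t * p y" if "0 \<le> t" for x t
    using sublinear_add[OF p, of "x + t *\<^sub>R y" "- x"] sublinear_scale[OF p that, of y] by simp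
  have bdd: "bdd_below ((\<lambda>t. p (x + t *\<^sub>R y) - t * p y) ` {0..})" for x
    by (rule bdd_belowI2[of _ "- p (- x)"]) (use lower in auto)
  have le: "q x \<le> p (x + t *\<^sub>R y) - t * p y" if "0 \<le> t" for x t
    unfolding q_def by (rule cINF_lower[OF bdd]) (use that in auto)
  have ge: "c \<le> q x" if "\<And>t. 0 \<le> t \<Longrightarrow> c \<le> p (x + t *\<^sub>R y) - t * p y" for c x
    unfolding q_def by (rule cINF_greatest) (use that in auto)
  have approx: "\<exists>t\<ge>0. p (x + t *\<^sub>R y) - t * p y < q x + e" if "0 < e" for x e
    using ge[of "q x + e" x] that by (meson add_le_same_cancel1 not_le)
  have "q x \<le> p x"
    using le[of 0 x] by simp
  then show "Inf_along p y x \<le> p x" by (simp add: q_eq)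
  have "q (- y) \<le> - p y"
    using le[of 1 "- y"] sublinear_zero[OF p] by simp
  then show "Inf_along p y (- y) \<le> - p y" by (simp add: q_eq)
  have add: "q (x + z) \<le> q x + q z" for x z
  proof (rule field_le_epsilon)
    fix e :: real assume e: "0 < e"
    obtain s where s: "0 \<le> s" "p (x + s *\<^sub>R y) - s * p y < q x + e / 2"
      using approx[of "e / 2" x] e by auto
    obtain t where t: "0 \<le> t" "p (z + t *\<^sub>R y) - t * p y < q z + e / 2"
      using approx[of "e / 2" z] e by auto
    have "q (x + z) \<le> p ((x + z) + (s + t) *\<^sub>R y) - (s + t) * p y"
      using le s t by auto
    also have "(x + z) + (s + t) *\<^sub>R y = (x + s *\<^sub>R y) + (z + t *\<^sub>R y)"
      by (simp add: algebra_simps)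
    finally show "q (x + z) \<le> q x + q z + e"
      using sublinear_add[OF p, of "x + s *\<^sub>R y" "z + t *\<^sub>R y"] s t
      by (simp add: algebra_simps)
  qed
  \<comment> \<open>One inequality for all positive \<open>r\<close> suffices: applied to
    \<open>inverse r\<close> and \<open>r *\<^sub>R x\<close> it yields the reverse one.\<close>
  have half: "q (r *\<^sub>R x) \<le> r * q x" if "0 < r" for r x
  proof -
    have "inverse r * q (r *\<^sub>R x) \<le> q x"
    proof (rule ge)
      fix t :: real assume "0 \<le> t"
      then have "q (r *\<^sub>R x) \<le> p (r *\<^sub>R x + (r * t) *\<^sub>R y) - (r * t) * p y"
        using le that by simp
      also have "\<dots> = r * (p (x + t *\<^sub>R y) - t * p y)"
        using sublinear_scale[OF p, of r "x + t *\<^sub>R y"] that by (simp add: algebra_simps)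
      finally show "inverse r * q (r *\<^sub>R x) \<le> p (x + t *\<^sub>R y) - t * p y"
        using that by (simp add: field_simps)
    qed
    then show ?thesis
      using that by (simp add: field_simps)
  qed
  have "q (r *\<^sub>R x) = r * q x" if "0 \<le> r" for r x
  proof (cases "r = 0")
    case True
    have "q 0 \<le> 0" using le[of 0 0] sublinear_zero[OF p] by simp
    moreover have "0 \<le> q 0" using ge[of 0 0] sublinear_scale[OF p] by simp
    ultimately show ?thesis using True by simp
  next
    case False
    then have "0 < r" using that by simp
    then show ?thesis
      using half[of r x] half[of "inverse r" "r *\<^sub>R x"] by (simp add: field_simps)
  qed
  with add have "sublinear q"
    unfolding sublinear_def by auto
  then show "sublinear (Inf_along p y)" by (simp add: q_eq)
qed

text \<open>Minimality forces \<open>Inf_along p y = p\<close>, hence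
  \<open>p (- y) \<le> - p y\<close>. So \<open>p\<close> is odd, and subadditivity at
  \<open>x, y\<close> and at \<open>- x, - y\<close> together is additivity.\<close>

lemma minimal_sublinear_imp_linear:
  assumes p: "sublinear p" and min: "\<And>q. sublinear q \<Longrightarrow> (\<And>x. q x \<le> p x) \<Longrightarrow> q = p"
  shows "linear p"
proof -
  have neg: "p (- y) = - p y" for y
  proof -
    have "Inf_along p y = p"
      by (rule min) (auto intro: sublinear_Inf_along Inf_along_le p)
    then have "p (- y) \<le> - p y"
      using Inf_along_minus[OF p, of y] by simp
    with sublinear_minus[OF p, of y] show ?thesis by simp
  qed
  show ?thesis
  proof (rule linearI)
    fix x y
    show "p (x + y) = p x + p y"
      using sublinear_add[OF p, of x y] sublinear_add[OF p, of "- x" "- y"] neg[of x] neg[of y]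
        neg[of "x + y"] by simp
  next
    fix r x
    show "p (r *\<^sub>R x) = r *\<^sub>R p x"
    proof (cases "0 \<le> r")
      case True
      then show ?thesis using sublinear_scale[OF p] by simp
    next
      case False
      then have "p (r *\<^sub>R x) = p ((- r) *\<^sub>R (- x))" by simp
      also have "\<dots> = r * p x"
        using False neg by (subst sublinear_scale[OF p]) auto
      finally show ?thesis by simp
    qed
  qed
qed

text \<open>Zorn's lemma, ordered downwards, on the sublinear functionals below \<open>p\<close>. A
  chain has its pointwise infimum as lower bound; comparability supplies one member below two
  near-optimal ones, which makes the infimum subadditive. Prescribed values are encoded in
  \<open>p\<close> instead of in a functional to be extended.\<close>

lemma Hahn_Banach_sublinear:
  fixes p :: "'v::real_vector \<Rightarrow> real"
  assumes p: "sublinear p"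
  obtains L where "linear L" "\<And>x. L x \<le> p x"
proof -
  define A where "A = {q. sublinear q \<and> (\<forall>x. q x \<le> p x)}"
  have "\<exists>m\<in>A. \<forall>a\<in>A. m \<ge> a \<longrightarrow> a = m"
  proof (rule predicate_Zorn)
    show "partial_order_on A (relation_of (\<ge>) A)"
      by (rule partial_order_on_relation_ofI) auto
  next
    fix C assume C: "C \<in> Chains (relation_of (\<ge>) A)"
    then have CA: "C \<subseteq> A" and lin: "\<And>a b. a \<in> C \<Longrightarrow> b \<in> C \<Longrightarrow> a \<le> b \<or> b \<le> a"
      by (auto simp: Chains_def relation_of_def)
    show "\<exists>u\<in>A. \<forall>a\<in>C. a \<ge> u"
    proof (cases "C = {}")
      case True
      then show ?thesis using p by (auto simp: A_def)
    next
      case False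
      define u where "u x = (INF q\<in>C. q x)" for x
      have bdd: "bdd_below ((\<lambda>q. q x) ` C)" for x
      proof (rule bdd_belowI2)
        fix q assume "q \<in> C"
        then have "sublinear q" "q (- x) \<le> p (- x)" using CA by (auto simp: A_def)
        with sublinear_minus[of q x] show "- p (- x) \<le> q x" by simp
      qed
      have le: "u x \<le> q x" if "q \<in> C" for q x
        unfolding u_def by (rule cINF_lower[OF bdd that])
      have ge: "c \<le> u x" if "\<And>q. q \<in> C \<Longrightarrow> c \<le> q x" for c x
        unfolding u_def by (rule cINF_greatest) (use that False in auto)
      have approx: "\<exists>q\<in>C. q x < u x + e" if "0 < e" for x e
        using ge[of "u x + e" x] that by (meson add_le_same_cancel1 not_le)
      have add: "u (x + y) \<le> u x + u y" for x y
      proof (rule field_le_epsilon)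
        fix e :: real assume e: "0 < e"
        obtain f where f: "f \<in> C" "f x < u x + e / 2" using approx[of "e / 2" x] e by auto
        obtain g where g: "g \<in> C" "g y < u y + e / 2" using approx[of "e / 2" y] e by auto
        obtain h where h: "h \<in> C" "h \<le> f" "h \<le> g" using lin f g by blast
        then have "sublinear h" using CA by (auto simp: A_def)
        then have "h (x + y) \<le> h x + h y" by (rule sublinear_add)
        then show "u (x + y) \<le> u x + u y + e"
          using le[OF h(1), of "x + y"] f g h(2,3) le_funD[of h f x] le_funD[of h g y] by linarith
      qed
      have scale: "u (r *\<^sub>R x) = r * u x" if r: "0 \<le> r" for r x
      proof -
        have sc: "q (r *\<^sub>R x) = r * q x" if "q \<in> C" for q
          using that CA r by (auto simp: A_def sublinear_scale)
        show ?thesis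
        proof (cases "r = 0")
          case True
          obtain q where "q \<in> C" using False by auto
          then have "u 0 \<le> 0" using le[of q 0] sc[of q] True by simp
          moreover have "0 \<le> u 0" using sc[of _] True by (intro ge) force
          ultimately show ?thesis using True by simp
        next
          case False
          then have r0: "0 < r" using r by simp
          have "inverse r * u (r *\<^sub>R x) \<le> u x"
            using le[of _ "r *\<^sub>R x"] sc r0 by (intro ge) (simp add: field_simps)
          moreover have "r * u x \<le> u (r *\<^sub>R x)"
          proof (rule ge)
            fix q assume q: "q \<in> C"
            show "r * u x \<le> q (r *\<^sub>R x)"
              unfolding sc[OF q] using le[OF q, of x] r0 by simp
          qed
          ultimately show ?thesis using r0 by (simp add: field_simps)
        qed
      qed
      have "u x \<le> p x" for x
      proof -
        obtain q where "q \<in> C" using False by auto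
        moreover from this have "q x \<le> p x" using CA by (auto simp: A_def)
        ultimately show ?thesis using le[of q x] by simp
      qed
      then have "u \<in> A"
        using add scale by (auto simp: A_def sublinear_def)
      then show ?thesis using le by (auto simp: le_fun_def)
    qed
  qed
  then obtain m where m: "m \<in> A" and min: "\<And>a. a \<in> A \<Longrightarrow> a \<le> m \<Longrightarrow> a = m" by blast
  have "linear m"
  proof (rule minimal_sublinear_imp_linear)
    show "sublinear m" using m by (auto simp: A_def)
    fix q assume "sublinear q" "\<And>x. q x \<le> m x"
    then show "q = m" using m by (intro min) (auto simp: A_def le_fun_def intro: order_trans)
  qed
  then show thesis using that m by (auto simp: A_def)
qed

text \<open>Starting from \<open>Inf_along norm x0\<close> instead of \<open>norm\<close> forces the
  value at \<open>x0\<close>.\<close>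

lemma norming_functional:
  fixes x0 :: "'a::real_normed_vector"
  obtains L where "linear L" "\<And>x. \<bar>L x\<bar> \<le> norm x" "L x0 = norm x0"
proof -
  note sn = sublinear_norm[where 'a = 'a]
  obtain L where L: "linear L" "\<And>x. L x \<le> Inf_along norm x0 x"
    using Hahn_Banach_sublinear[OF sublinear_Inf_along[OF sn]] by blast
  have le: "L x \<le> norm x" for x
    using L(2)[of x] Inf_along_le[OF sn, of x0 x] by linarith
  have "\<bar>L x\<bar> \<le> norm x" for x
    using le[of x] le[of "- x"] linear_neg[OF L(1), of x] by simp
  moreover have "L x0 = norm x0"
    using le[of x0] L(2)[of "- x0"] Inf_along_minus[OF sn, of x0] linear_neg[OF L(1), of x0] by linarith
  ultimately show thesis using that L(1) by blast
qed

text \<open>A linear functional below the limit superior, which is written here as the infimum of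
  all eventual upper bounds. It replaces the choice of a convergent subsequence when uncountably
  many functionals are evaluated along one sequence.\<close>

lemma generalized_limit:
  "\<exists>L :: (nat \<Rightarrow>\<^sub>C real) \<Rightarrow> real.
    linear L \<and> (\<forall>w c. (\<forall>\<^sub>F n in sequentially. apply_bcontfun w n \<le> c) \<longrightarrow> L w \<le> c)"
proof -
  define E where "E w = {c. \<forall>\<^sub>F n in sequentially. apply_bcontfun w n \<le> c}" for w :: "nat \<Rightarrow>\<^sub>C real"
  define p where "p w = Inf (E w)" for w
  have bnd: "\<bar>apply_bcontfun w n\<bar> \<le> norm w" for w :: "nat \<Rightarrow>\<^sub>C real" and n
    using norm_bounded[of w n] by simp
  have ne: "norm w \<in> E w" for w
    unfolding E_def using bnd[of w] by (auto simp: abs_le_iff)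
  have lb: "- norm w \<le> c" if "c \<in> E w" for c w
  proof -
    from that obtain n where "apply_bcontfun w n \<le> c"
      unfolding E_def eventually_sequentially by auto
    then show ?thesis using bnd[of w n] by linarith
  qed
  have bdd: "bdd_below (E w)" for w
    using lb by (rule bdd_belowI)
  have le: "p w \<le> c" if "c \<in> E w" for c w
    unfolding p_def by (rule cInf_lower[OF that bdd])
  have ge: "c \<le> p w" if "\<And>d. d \<in> E w \<Longrightarrow> c \<le> d" for c w
    unfolding p_def by (rule cInf_greatest) (use ne that in auto)
  have approx: "\<exists>c\<in>E w. c < p w + e" if "0 < e" for w e
    using ge[of w "p w + e"] that by (meson add_le_same_cancel1 not_le)
  have add: "p (v + w) \<le> p v + p w" for v w
  proof (rule field_le_epsilon)
    fix e :: real assume e: "0 < e"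
    obtain c where c: "c \<in> E v" "c < p v + e / 2" using approx[of "e / 2" v] e by auto
    obtain d where d: "d \<in> E w" "d < p w + e / 2" using approx[of "e / 2" w] e by auto
    have "c + d \<in> E (v + w)"
      using c(1) d(1) unfolding E_def by (auto elim: eventually_elim2 simp: plus_bcontfun.rep_eq)
    from le[OF this] show "p (v + w) \<le> p v + p w + e" using c d by linarith
  qed
  have half: "p (r *\<^sub>R w) \<le> r * p w" if r: "0 < r" for r w
  proof -
    have "inverse r * p (r *\<^sub>R w) \<le> p w"
    proof (rule ge)
      fix c assume "c \<in> E w"
      then have "r * c \<in> E (r *\<^sub>R w)"
        using r unfolding E_def by (auto elim: eventually_mono simp: scaleR_bcontfun.rep_eq)
      from le[OF this] show "inverse r * p (r *\<^sub>R w) \<le> c" using r by (simp add: field_simps)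
    qed
    then show ?thesis using r by (simp add: field_simps)
  qed
  have "p (r *\<^sub>R w) = r * p w" if r: "0 \<le> r" for r w
  proof (cases "r = 0")
    case True
    have "p 0 = 0"
      using le[OF ne[of 0]] ge[of 0 0] lb[of _ 0] by (auto intro: antisym)
    then show ?thesis using True by simp
  next
    case False
    then show ?thesis
      using half[of r w] half[of "inverse r" "r *\<^sub>R w"] r by (simp add: field_simps)
  qed
  with add have "sublinear p" by (auto simp: sublinear_def)
  then obtain L where L: "linear L" "\<And>w. L w \<le> p w"
    using Hahn_Banach_sublinear by metis
  have "L w \<le> c" if "\<forall>\<^sub>F n in sequentially. apply_bcontfun w n \<le> c" for w c
    using L(2)[of w] le[of c w] that by (simp add: E_def)
  with L(1) show ?thesis by blast
qed

section \<open>From a gain at one length to an upper q-estimate\<close>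

text \<open>Half-open intervals counted from 0 let blocks concatenate and shift without index
  corrections. The additional case \<open>a = b\<close> has left side 0 and so holds for every
  \<open>C \<ge> 0\<close>.\<close>

definition dominating :: "real \<Rightarrow> (nat \<Rightarrow> 'a::real_normed_vector) \<Rightarrow> bool" where
  "dominating C f \<longleftrightarrow> (\<forall>a b c. a \<le> b \<and> b \<le> c \<longrightarrow>
     norm (sum f {a..<b}) \<le> C * norm (sum f {a..<b} - sum f {b..<c}))"

lemma dominatingD:
  "dominating C f \<Longrightarrow> a \<le> b \<Longrightarrow> b \<le> c \<Longrightarrow>
     norm (sum f {a..<b}) \<le> C * norm (sum f {a..<b} - sum f {b..<c})"
  by (auto simp: dominating_def)

lemma dominating_scaleR:
  assumes "dominating C f"
  shows "dominating C (\<lambda>i. r *\<^sub>R f i)"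
  unfolding dominating_def
proof (intro allI impI)
  fix a b c :: nat assume "a \<le> b \<and> b \<le> c"
  then have "norm (sum f {a..<b}) \<le> C * norm (sum f {a..<b} - sum f {b..<c})"
    using assms by (auto simp: dominating_def)
  then have "\<bar>r\<bar> * norm (sum f {a..<b}) \<le> \<bar>r\<bar> * (C * norm (sum f {a..<b} - sum f {b..<c}))"
    by (rule mult_left_mono) simp
  also have "\<dots> = C * norm (r *\<^sub>R (sum f {a..<b} - sum f {b..<c}))"
    by simp
  finally show "norm (\<Sum>i = a..<b. r *\<^sub>R f i)
      \<le> C * norm ((\<Sum>i = a..<b. r *\<^sub>R f i) - (\<Sum>i = b..<c. r *\<^sub>R f i))"
    by (simp add: scaleR_sum_right[symmetric] scaleR_diff_right[symmetric])
qed

lemma sum_consecutive_blocks: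
  fixes f :: "nat \<Rightarrow> 'a::comm_monoid_add"
  assumes "mono p" "a \<le> b"
  shows "(\<Sum>k = a..<b. sum f {p k..<p (Suc k)}) = sum f {p a..<p b}"
  using assms(2)
proof (induction b rule: dec_induct)
  case (step n)
  have "p a \<le> p n" "p n \<le> p (Suc n)" using step assms(1) by (auto intro: monoD)
  with step show ?case by (simp add: sum.atLeastLessThan_concat)
qed simp

text \<open>Interval sums of the block sums are interval sums of \<open>f\<close>. Monotone cut
  points may repeat; the resulting empty blocks do occur when a single term carries much of the
  mass.\<close>

lemma dominating_blocks:
  assumes "dominating C f" "mono p"
  shows "dominating C (\<lambda>k. sum f {p k..<p (Suc k)})"
  unfolding dominating_def
  using assms by (auto simp: sum_consecutive_blocks intro!: dominatingD intro: monoD)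

lemma dominating_shift:
  assumes "dominating C f"
  shows "dominating C (\<lambda>i. f (m + i))"
  unfolding dominating_def
proof (intro allI impI)
  fix a b c :: nat assume *: "a \<le> b \<and> b \<le> c"
  have "(\<Sum>i = a..<b. f (m + i)) = sum f {m + a..<m + b}" for a b
    using sum.shift_bounds_nat_ivl[of f a m b] by (simp add: add.commute)
  then show "norm (\<Sum>i = a..<b. f (m + i))
      \<le> C * norm ((\<Sum>i = a..<b. f (m + i)) - (\<Sum>i = b..<c. f (m + i)))"
    using dominatingD[OF assms, of "m + a" "m + b" "m + c"] * by simp
qed

text \<open>As \<open>q\<close> decreases to 1 the expression tends to \<open>A / N\<close>, which
  is below 1.\<close>

lemma powr_exponent_slack:
  fixes A N :: real
  assumes "0 < A" "A < N" "1 < N"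
  obtains q where "q > 1" "A * N powr (- 1 / q) < 1"
proof -
  have "((\<lambda>q. A * N powr (- 1 / q)) \<longlongrightarrow> A * N powr (- 1 / 1)) (at_right 1)"
    using assms by (intro tendsto_intros) auto
  moreover have "A * N powr (- 1 / 1) < 1"
    using assms by (simp add: powr_minus field_simps)
  ultimately have "\<forall>\<^sub>F q in at_right 1. A * N powr (- 1 / q) < 1"
    by (rule order_tendstoD)
  moreover have "\<forall>\<^sub>F q::real in at_right 1. 1 < q"
    by (simp add: eventually_at_filter)
  ultimately have "\<forall>\<^sub>F q in at_right 1. 1 < q \<and> A * N powr (- 1 / q) < 1"
    by (rule eventually_conj[rotated])
  then obtain q where "1 < q \<and> A * N powr (- 1 / q) < 1"
    using eventually_happens[of _ "at_right (1::real)"] by (auto simp: trivial_limit_at_right_real)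
  then show thesis using that by blast
qed

text \<open>Passing from the blocks to the whole sum turns a constant \<open>K\<close> into
  \<open>A * (K * N powr (- 1 / q) + 1)\<close>. This map is affine with slope below 1, which is why
  one constant serves all lengths.\<close>

lemma upper_estimate_sum:
  fixes f :: "nat \<Rightarrow> 'a::real_normed_vector"
  assumes N: "2 \<le> N" and A: "0 < A" and q: "q > 1" and rho: "A * real N powr (- 1 / q) < 1"
    and flat: "\<And>u :: nat \<Rightarrow> 'a. dominating C u \<Longrightarrow> (\<And>i. norm (u i) \<le> 1) \<Longrightarrow> norm (\<Sum>i<N. u i) \<le> A"
    and f: "dominating C f"
  defines "K \<equiv> A / (1 - A * real N powr (- 1 / q))"
  shows "norm (\<Sum>i<L. f i) \<le> K * (\<Sum>i<L. norm (f i) powr q) powr (1 / q)"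
  using f
proof (induction L arbitrary: f rule: less_induct)
  case (less L)
  define F where "F m = (\<Sum>i<m. norm (f i) powr q)" for m
  have K: "0 < K" using A rho by (simp add: K_def)
  have F_mono: "F m \<le> F n" if "m \<le> n" for m n
    unfolding F_def using that by (intro sum_mono2) auto
  have F0: "F 0 = 0" by (simp add: F_def)
  show ?case
  proof (cases "F L = 0")
    case True
    then have "\<And>i. i < L \<Longrightarrow> f i = 0"
      unfolding F_def by (subst (asm) sum_nonneg_eq_0_iff) auto
    then show ?thesis using K by simp
  next
    case False
    then have Q: "0 < F L" unfolding F_def by (simp add: less_le sum_nonneg)
    define Q where "Q = F L"
    have Qpos: "0 < Q" using Q by (simp add: Q_def)
    \<comment> \<open>The first \<open>p k - 1\<close> terms carry less than \<open>k/N\<close> of the mass, so a block without its last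
      term has mass at most \<open>Q/N\<close>; the last term is estimated separately.\<close>
    define p where "p k = (LEAST m. m = L \<or> F m \<ge> real k * Q / real N)" for k
    \<comment> \<open>The alternative \<open>m = L\<close> makes the least index exist for every
      \<open>k\<close>, also for \<open>k > N\<close>, where the threshold exceeds the mass
      \<open>Q\<close> of the first \<open>L\<close> terms.\<close>
    have p_prop: "p k = L \<or> F (p k) \<ge> real k * Q / real N" for k
      unfolding p_def by (rule LeastI[where k = L]) simp
    have p_le: "p k \<le> m" if "m = L \<or> F m \<ge> real k * Q / real N" for k m
      unfolding p_def using that by (rule Least_le)
    have p0: "p 0 = 0" using p_le[where k = 0 and m = 0] F0 by simp
    have pL: "p k \<le> L" for k using p_le[where m = L] by simp
    have p_mono: "mono p"
    proof (rule monoI)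
      fix k l :: nat assume "k \<le> l"
      then have "real k * Q / real N \<le> real l * Q / real N"
        using Qpos by (intro divide_right_mono mult_right_mono) auto
      then show "p k \<le> p l"
        using p_prop[of l] by (intro p_le) auto
    qed
    have pN: "F (p N) = Q"
      using p_prop[of N] N F_mono[OF pL[of N]] Q_def by auto
    define b where "b k = sum f {p k..<p (Suc k)}" for k
    \<comment> \<open>Bound for one block: \<open>K * (Q / N) powr (1 / q)\<close> for all but its
      last term, and \<open>Q powr (1 / q)\<close> for the last term.\<close>
    define D where "D = Q powr (1 / q) * (K * real N powr (- 1 / q) + 1)"
    have Dpos: "0 < D" unfolding D_def using Qpos K by (intro mult_pos_pos add_nonneg_pos) auto
    have single: "norm (f i) \<le> Q powr (1 / q)" if "i < L" for i
    proof -
      have "norm (f i) powr q \<le> Q"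
        unfolding Q_def F_def using that by (intro member_le_sum) auto
      then have "(norm (f i) powr q) powr (1 / q) \<le> Q powr (1 / q)"
        using q by (intro powr_mono2) auto
      then show ?thesis using q by (simp add: powr_powr)
    qed
    have b_le: "norm (b k) \<le> D" for k
    proof (cases "p k < p (Suc k)")
      case False
      then show ?thesis using Dpos by (simp add: b_def)
    next
      case True
      define s l where "s = p k" and "l = p (Suc k) - 1 - p k"
      have e: "p (Suc k) = Suc (s + l)" using True by (simp add: s_def l_def)
      have lL: "s + l < L" using pL[of "Suc k"] e by simp
      have "norm (\<Sum>i<l. f (s + i)) \<le> K * (\<Sum>i<l. norm (f (s + i)) powr q) powr (1 / q)"
        using lL by (intro less.IH dominating_shift less.prems) simp
      also have "\<dots> \<le> K * (Q / real N) powr (1 / q)"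
      proof -
        have "F (s + l) < real (Suc k) * Q / real N"
        proof (rule ccontr)
          assume "\<not> ?thesis"
          then have "p (Suc k) \<le> s + l" by (intro p_le) simp
          then show False using e by simp
        qed
        moreover have "F s \<ge> real k * Q / real N"
          using p_prop[of k] lL by (auto simp: s_def)
        moreover have "F (s + l) = F s + (\<Sum>i<l. norm (f (s + i)) powr q)"
          unfolding F_def by (induction l) (auto simp: add_ac)
        moreover have "real (Suc k) * Q / real N = real k * Q / real N + Q / real N"
          by (simp add: add_divide_distrib distrib_right)
        ultimately have "(\<Sum>i<l. norm (f (s + i)) powr q) \<le> Q / real N"
          by linarith
        then show ?thesis using K q by (intro mult_left_mono powr_mono2) (auto intro: sum_nonneg)
      qed
      also have "(Q / real N) powr (1 / q) = Q powr (1 / q) * real N powr (- 1 / q)"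
        using Qpos N by (simp add: powr_divide powr_minus_divide)
      finally have 1: "norm (\<Sum>i<l. f (s + i)) \<le> K * (Q powr (1 / q) * real N powr (- 1 / q))" .
      have "b k = sum f {s..<s + l} + f (s + l)"
        unfolding b_def e s_def[symmetric] by simp
      also have "sum f {s..<s + l} = (\<Sum>i<l. f (s + i))"
        using sum.shift_bounds_nat_ivl[of f 0 s l] by (simp add: add.commute lessThan_atLeast0)
      finally have "norm (b k) \<le> norm (\<Sum>i<l. f (s + i)) + norm (f (s + l))"
        by (simp add: norm_triangle_ineq)
      also have "\<dots> \<le> D"
        using 1 single[OF lL] by (simp add: D_def algebra_simps)
      finally show ?thesis .
    qed
    have "dominating C b"
      unfolding b_def by (rule dominating_blocks[OF less.prems p_mono])
    then have "dominating C (\<lambda>k. (1 / D) *\<^sub>R b k)" by (rule dominating_scaleR)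
    then have "norm (\<Sum>k<N. (1 / D) *\<^sub>R b k) \<le> A"
      using b_le Dpos by (intro flat) (auto simp: field_simps)
    then have "norm (\<Sum>k<N. b k) \<le> A * D"
      using Dpos by (simp add: scaleR_sum_right[symmetric] field_simps)
    \<comment> \<open>\<open>K\<close> is the fixed point of \<open>K = A (K N\<^bsup>-1/q\<^esup> + 1)\<close>.\<close>
    also have "A * D = K * Q powr (1 / q)"
    proof -
      have "K * (1 - A * real N powr (- 1 / q)) = A" using rho by (simp add: K_def)
      then have "A * (K * real N powr (- 1 / q) + 1) = K" by (simp add: algebra_simps)
      then show ?thesis by (simp add: D_def)
    qed
    also have "(\<Sum>k<N. b k) = (\<Sum>i<L. f i)"
    proof -
      have "(\<Sum>k<N. b k) = sum f {0..<p N}"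
        using sum_consecutive_blocks[OF p_mono, of 0 N f] by (simp add: b_def p0 lessThan_atLeast0)
      \<comment> \<open>The cut \<open>p N\<close> may fall short of \<open>L\<close>, but it has
        already collected the whole mass, so the terms from there to \<open>L\<close>
        vanish.\<close>
      also have "\<dots> = sum f {0..<L}"
      proof (rule sum.mono_neutral_left)
        show "\<forall>i\<in>{0..<L} - {0..<p N}. f i = 0"
        proof
          fix i assume "i \<in> {0..<L} - {0..<p N}"
          then have i: "p N \<le> i" "i < L" by auto
          then have "F (Suc i) \<le> F (p N)" using F_mono[of "Suc i" L] pN by (simp add: Q_def)
          moreover have "F (p N) \<le> F i" using F_mono i by blast
          moreover have "F (Suc i) = F i + norm (f i) powr q" by (simp add: F_def)
          ultimately have "norm (f i) powr q \<le> 0" by linarith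
          then show "f i = 0" by (metis antisym powr_ge_zero powr_eq_0_iff norm_eq_zero)
        qed
      qed (use pL in auto)
      finally show ?thesis by (simp add: lessThan_atLeast0)
    qed
    finally show ?thesis by (simp add: Q_def F_def)
  qed
qed

section \<open>From finite sums to convergent series\<close>

lemma upper_estimate_series:
  fixes f :: "nat \<Rightarrow> 'a::banach"
  assumes K: "0 < K" and q: "q > 1"
    and est: "\<And>(f :: nat \<Rightarrow> 'a) L. dominating C f \<Longrightarrow>
      norm (\<Sum>i<L. f i) \<le> K * (\<Sum>i<L. norm (f i) powr q) powr (1 / q)"
    and f: "dominating C f" and summ: "summable (\<lambda>n. norm (f n) powr q)"
  shows "summable f" "norm (suminf f) \<le> K * (\<Sum>n. norm (f n) powr q) powr (1 / q)"
proof -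
  show sf: "summable f"
    unfolding summable_Cauchy
  proof (intro allI impI)
    fix e :: real assume e: "0 < e"
    have "0 < (e / K) powr q" using e K by simp
    with summ obtain M where M: "\<And>m n. m \<ge> M \<Longrightarrow> norm (\<Sum>i=m..<n. norm (f i) powr q) < (e / K) powr q"
      unfolding summable_Cauchy by blast
    show "\<exists>M. \<forall>m\<ge>M. \<forall>n. norm (sum f {m..<n}) < e"
    proof (intro exI allI impI)
      fix m n assume m: "M \<le> m"
      show "norm (sum f {m..<n}) < e"
      proof (cases "m \<le> n")
        case False
        then show ?thesis using e by simp
      next
        case True
        then obtain l where n: "n = m + l" using le_Suc_ex by blast
        have sh: "sum g {m..<n} = (\<Sum>i<l. g (m + i))" for g :: "nat \<Rightarrow> 'b::comm_monoid_add"
          using sum.shift_bounds_nat_ivl[of g 0 m l] n by (simp add: add.commute lessThan_atLeast0)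
        \<comment> \<open>A shifted sequence is again dominating, so the estimate for initial sums
          bounds every segment by the corresponding segment of the series of powers.\<close>
        have "norm (sum f {m..<n}) \<le> K * (\<Sum>i<l. norm (f (m + i)) powr q) powr (1 / q)"
          unfolding sh by (rule est[OF dominating_shift[OF f]])
        also have "(\<Sum>i<l. norm (f (m + i)) powr q) = (\<Sum>i=m..<n. norm (f i) powr q)"
          by (simp add: sh)
        also have "(\<Sum>i=m..<n. norm (f i) powr q) powr (1 / q) < ((e / K) powr q) powr (1 / q)"
          using M[OF m, of n] q by (intro powr_less_mono2) (auto intro: sum_nonneg)
        also have "((e / K) powr q) powr (1 / q) = e / K" using q e K by (simp add: powr_powr)
        finally show ?thesis using K by simp
      qed
    qed
  qed
  have "(\<lambda>L. norm (\<Sum>i<L. f i)) \<longlonglongrightarrow> norm (suminf f)"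
    using summable_LIMSEQ[OF sf] by (rule tendsto_norm)
  moreover have "norm (\<Sum>i<L. f i) \<le> K * (\<Sum>n. norm (f n) powr q) powr (1 / q)" for L
  proof -
    have "norm (\<Sum>i<L. f i) \<le> K * (\<Sum>i<L. norm (f i) powr q) powr (1 / q)"
      by (rule est[OF f])
    also have "\<dots> \<le> K * (\<Sum>n. norm (f n) powr q) powr (1 / q)"
      using K q by (intro mult_left_mono powr_mono2 sum_le_suminf summ) (auto intro: sum_nonneg)
    finally show ?thesis .
  qed
  ultimately show "norm (suminf f) \<le> K * (\<Sum>n. norm (f n) powr q) powr (1 / q)"
    by (intro LIMSEQ_le_const2) auto
qed

section \<open>Limits of sequences of vector families\<close>

text \<open>An enumeration of the finitely supported rational sequences: \<open>k\<close> codes a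
  list of rationals, padded with zeros. Countability is essential, since each code will give one
  coordinate of a bounded sequence.\<close>

definition rat_coeff :: "nat \<Rightarrow> nat \<Rightarrow> real" where
  "rat_coeff k m = (if m < length (from_nat k :: rat list) then of_rat (from_nat k ! m) else 0)"

lemma rat_coeff_eventually_0: "\<exists>M. \<forall>m\<ge>M. rat_coeff k m = 0"
  unfolding rat_coeff_def by (rule exI[of _ "length (from_nat k :: rat list)"]) auto

lemma rat_coeff_dense:
  assumes "0 < \<eta>"
  shows "\<exists>k. (\<forall>m\<ge>M. rat_coeff k m = 0) \<and> (\<forall>m. m < M \<longrightarrow> \<bar>a m - rat_coeff k m\<bar> < \<eta>)"
proof -
  have "\<exists>q. \<bar>a m - of_rat q\<bar> < \<eta>" for m
  proof -
    obtain q where "a m < of_rat q" "of_rat q < a m + \<eta>"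
      using of_rat_dense[of "a m" "a m + \<eta>"] assms by auto
    then show ?thesis by (intro exI[of _ q]) auto
  qed
  then obtain q where q: "\<And>m. \<bar>a m - of_rat (q m)\<bar> < \<eta>" by metis
  define k where "k = to_nat (map q [0..<M])"
  show ?thesis
    by (rule exI[of _ k]) (use q in \<open>auto simp: rat_coeff_def k_def\<close>)
qed

lemma norm_combination_diff_le:
  fixes x :: "nat \<Rightarrow> 'a::real_normed_vector"
  assumes x: "\<And>m. norm (x m) \<le> 1" and ab: "\<And>m. m < M \<Longrightarrow> \<bar>a m - b m\<bar> \<le> \<eta>"
  shows "norm ((\<Sum>m<M. a m *\<^sub>R x m) - (\<Sum>m<M. b m *\<^sub>R x m)) \<le> real M * \<eta>"
proof -
  have "(\<Sum>m<M. a m *\<^sub>R x m) - (\<Sum>m<M. b m *\<^sub>R x m) = (\<Sum>m<M. (a m - b m) *\<^sub>R x m)"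
    by (simp add: sum_subtractf scaleR_left_diff_distrib)
  also have "norm \<dots> \<le> (\<Sum>m<M. \<eta>)"
  proof (rule sum_norm_le)
    fix m assume "m \<in> {..<M}"
    then have "\<bar>a m - b m\<bar> \<le> \<eta>" using ab by simp
    then have "\<bar>a m - b m\<bar> * norm (x m) \<le> \<eta> * 1"
      using x[of m] by (intro mult_mono) auto
    then show "norm ((a m - b m) *\<^sub>R x m) \<le> \<eta>" by simp
  qed
  finally show ?thesis by simp
qed

text \<open>
  The coordinates of \<open>e m\<close> are limits of functionals that norm the rational combinations; by
  density of the latter they norm all combinations.
\<close>

lemma limit_space:
  fixes x :: "nat \<Rightarrow> nat \<Rightarrow> 'a::real_normed_vector"
  assumes x: "\<And>n m. norm (x n m) \<le> 1"
  obtains r :: "nat \<Rightarrow> nat" and e :: "nat \<Rightarrow> nat \<Rightarrow>\<^sub>C real" where "strict_mono r"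
    "\<And>M a. (\<lambda>n. norm (\<Sum>m<M. a m *\<^sub>R x (r n) m)) \<longlonglongrightarrow> norm (\<Sum>m<M. a m *\<^sub>R e m)"
proof -
  obtain len where len: "\<And>k m. len k \<le> m \<Longrightarrow> rat_coeff k m = 0"
    using rat_coeff_eventually_0 by metis
  define y where "y k n = (\<Sum>m<len k. rat_coeff k m *\<^sub>R x n m)" for k n
  have "\<exists>L. linear L \<and> (\<forall>v. \<bar>L v\<bar> \<le> norm v) \<and> L (y k n) = norm (y k n)" for k n
    by (rule norming_functional[of "y k n"]) blast
  then obtain \<phi> where \<phi>: "\<And>k n. linear (\<phi> k n)" "\<And>k n v. \<bar>\<phi> k n v\<bar> \<le> norm v"
    and \<phi>_norming: "\<And>k n. \<phi> k n (y k n) = norm (y k n)"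
    by metis
  have \<phi>_bnd: "\<bar>\<phi> k n (x n m)\<bar> \<le> 1" for k n m
    using \<phi>(2)[of k n "x n m"] x[of n m] by linarith
  \<comment> \<open>The index pairs \<open>(k, m)\<close> are countable and the values bounded by 1,
    so a diagonal subsequence makes all coordinates converge at once.\<close>
  obtain r where r: "strict_mono (r :: nat \<Rightarrow> nat)"
    and r_lim: "\<And>i. i \<in> UNIV \<Longrightarrow> \<exists>l. (\<lambda>n. (\<lambda>n (k, m). \<phi> k n (x n m)) (r n) i) \<longlonglongrightarrow> l"
    by (rule function_convergent_subsequence[where S = "UNIV :: (nat \<times> nat) set"
          and f = "\<lambda>n (k, m). \<phi> k n (x n m)" and M = 1])
      (use \<phi>_bnd in auto)
  have "\<exists>l. (\<lambda>n. \<phi> k (r n) (x (r n) m)) \<longlonglongrightarrow> l" for k m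
    using r_lim[of "(k, m)"] by simp
  then obtain g where g: "\<And>k m. (\<lambda>n. \<phi> k (r n) (x (r n) m)) \<longlonglongrightarrow> g k m" by metis
  have g_bnd: "\<bar>g k m\<bar> \<le> 1" for k m
    using \<phi>_bnd by (intro LIMSEQ_le_const2[OF tendsto_rabs[OF g]]) auto
  define e where "e m = Bcontfun (\<lambda>k. g k m)" for m
  have e: "apply_bcontfun (e m) k = g k m" for m k
    unfolding e_def using g_bnd
    by (subst Bcontfun_inverse) (auto intro!: bcontfun_normI[where b = 1])
  have "(\<lambda>n. norm (\<Sum>m<M. a m *\<^sub>R x (r n) m)) \<longlonglongrightarrow> norm (\<Sum>m<M. a m *\<^sub>R e m)" for M a
  proof -
    define u where "u n = (\<Sum>m<M. a m *\<^sub>R x (r n) m)" for n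
    define v where "v = (\<Sum>m<M. a m *\<^sub>R e m)"
    have v_apply: "apply_bcontfun v k = (\<Sum>m<M. a m * g k m)" for k
      unfolding v_def by (induction M) (auto simp: plus_bcontfun.rep_eq scaleR_bcontfun.rep_eq e)
    have lim: "(\<lambda>n. \<phi> k (r n) (u n)) \<longlonglongrightarrow> apply_bcontfun v k" for k
      unfolding u_def v_apply linear_sum[OF \<phi>(1)] linear_scale[OF \<phi>(1)] real_scaleR_def
      by (intro tendsto_intros g)
    \<comment> \<open>The functional norming a rational approximation \<open>z n\<close> of
      \<open>u n\<close> nearly norms \<open>u n\<close> itself: the exchange costs
      \<open>\<epsilon> / 3\<close> twice, and the last third pays for convergence to a coordinate
      of \<open>v\<close>. The summand 1 in \<open>real M + 1\<close> covers
      \<open>M = 0\<close>.\<close>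
    have upper: "\<forall>\<^sub>F n in sequentially. norm (u n) < norm v + \<epsilon>" if "0 < \<epsilon>" for \<epsilon>
    proof -
      define \<eta> where "\<eta> = \<epsilon> / (3 * (real M + 1))"
      have \<eta>: "0 < \<eta>" using that by (simp add: \<eta>_def)
      obtain k where k0: "\<And>m. m \<ge> M \<Longrightarrow> rat_coeff k m = 0"
        and k: "\<And>m. m < M \<Longrightarrow> \<bar>a m - rat_coeff k m\<bar> < \<eta>"
        using rat_coeff_dense[OF \<eta>] by blast
      define z where "z n = (\<Sum>m<M. rat_coeff k m *\<^sub>R x (r n) m)" for n
      have z: "\<phi> k (r n) (z n) = norm (z n)" for n
      proof -
        have "z n = (\<Sum>m<max M (len k). rat_coeff k m *\<^sub>R x (r n) m)"
          unfolding z_def by (rule sum.mono_neutral_left) (auto simp: k0)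
        also have "\<dots> = (\<Sum>m<len k. rat_coeff k m *\<^sub>R x (r n) m)"
          by (rule sum.mono_neutral_right) (auto simp: len)
        also have "\<dots> = y k (r n)" by (simp add: y_def)
        finally show ?thesis by (simp add: \<phi>_norming)
      qed
      have yz: "norm (u n - z n) \<le> \<epsilon> / 3" for n
      proof -
        have "norm (u n - z n) \<le> real M * \<eta>"
          unfolding u_def z_def using k by (intro norm_combination_diff_le x) (auto intro: less_imp_le)
        also have "\<dots> \<le> \<epsilon> / 3" using that by (simp add: \<eta>_def field_simps)
        finally show ?thesis .
      qed
      have "\<forall>\<^sub>F n in sequentially. \<phi> k (r n) (u n) < norm v + \<epsilon> / 3"
      proof (rule order_tendstoD(2)[OF lim])
        have "apply_bcontfun v k \<le> norm v" using norm_bounded[of v k] by simp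
        then show "apply_bcontfun v k < norm v + \<epsilon> / 3" using that by simp
      qed
      then show ?thesis
      proof (rule eventually_mono)
        fix n assume n: "\<phi> k (r n) (u n) < norm v + \<epsilon> / 3"
        have "\<phi> k (r n) (u n) = norm (z n) + \<phi> k (r n) (u n - z n)"
          by (simp add: linear_diff[OF \<phi>(1)] z)
        then show "norm (u n) < norm v + \<epsilon>"
          using n yz[of n] \<phi>(2)[of k "r n" "u n - z n"] norm_triangle_sub[of "u n" "z n"]
          by linarith
      qed
    qed
    \<comment> \<open>The supremum norm of \<open>v\<close> is nearly attained at some coordinate,
      and the functionals behind that coordinate have norm at most 1.\<close>
    have lower: "\<forall>\<^sub>F n in sequentially. norm v - \<epsilon> < norm (u n)" if "0 < \<epsilon>" for \<epsilon>
    proof -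
      have "\<exists>k. norm v - \<epsilon> < \<bar>apply_bcontfun v k\<bar>"
        using norm_bound[of v "norm v - \<epsilon>"] that by (force simp: not_le[symmetric])
      then obtain k where k: "norm v - \<epsilon> < \<bar>apply_bcontfun v k\<bar>" by blast
      have "\<forall>\<^sub>F n in sequentially. norm v - \<epsilon> < \<bar>\<phi> k (r n) (u n)\<bar>"
        by (rule order_tendstoD(1)[OF tendsto_rabs[OF lim] k])
      then show ?thesis
        by (rule eventually_mono) (use \<phi>(2) in \<open>force intro: less_le_trans\<close>)
    qed
    have "(\<lambda>n. norm (u n)) \<longlonglongrightarrow> norm v"
    proof (rule order_tendstoI)
      fix c assume "c < norm v"
      then show "\<forall>\<^sub>F n in sequentially. c < norm (u n)" using lower[of "norm v - c"] by simp
    next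
      fix c assume "norm v < c"
      then show "\<forall>\<^sub>F n in sequentially. norm (u n) < c" using upper[of "c - norm v"] by simp
    qed
    then show ?thesis by (simp add: u_def v_def)
  qed
  with r show thesis using that by blast
qed

section \<open>Closed subspaces of the bounded sequences as Banach spaces\<close>

lemma subspace_closure:
  fixes V :: "'b::real_normed_vector set"
  assumes V: "subspace V"
  shows "subspace (closure V)"
  unfolding subspace_def
proof (intro conjI ballI allI)
  show "0 \<in> closure V" using subspace_0[OF V] closure_subset by blast
next
  fix x y assume "x \<in> closure V" "y \<in> closure V"
  then obtain f g where f: "\<And>n. f n \<in> V" "f \<longlonglongrightarrow> x" and g: "\<And>n. g n \<in> V" "g \<longlonglongrightarrow> y"
    unfolding closure_sequential by metis
  show "x + y \<in> closure V"
    unfolding closure_sequential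
    by (rule exI[of _ "\<lambda>n. f n + g n"]) (use f g in \<open>auto intro: subspace_add[OF V] tendsto_add\<close>)
next
  fix c x assume "x \<in> closure V"
  then obtain f where f: "\<And>n. f n \<in> V" "f \<longlonglongrightarrow> x"
    unfolding closure_sequential by metis
  show "c *\<^sub>R x \<in> closure V"
    unfolding closure_sequential
    by (rule exI[of _ "\<lambda>n. c *\<^sub>R f n"]) (use f in \<open>auto intro: subspace_scale[OF V] tendsto_intros\<close>)
qed

lemma complete_UNIV_bcontfun:
  "complete (UNIV :: ('t::topological_space \<Rightarrow>\<^sub>C 'b::complete_space) set)"
  unfolding complete_def
proof (intro allI impI)
  fix f :: "nat \<Rightarrow> 't \<Rightarrow>\<^sub>C 'b"
  assume f: "(\<forall>n. f n \<in> UNIV) \<and> Cauchy f"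
  have "uniformly_Cauchy_on UNIV (\<lambda>n. apply_bcontfun (f n))"
    unfolding uniformly_Cauchy_on_def
  proof (intro allI impI)
    fix \<epsilon> :: real assume "0 < \<epsilon>"
    with f obtain M where "\<And>m n. M \<le> m \<Longrightarrow> M \<le> n \<Longrightarrow> dist (f m) (f n) < \<epsilon>"
      unfolding Cauchy_def by blast
    then show "\<exists>M. \<forall>t\<in>UNIV. \<forall>m\<ge>M. \<forall>n\<ge>M. dist (apply_bcontfun (f m) t) (apply_bcontfun (f n) t) < \<epsilon>"
      by (intro exI[of _ M]) (simp add: dist_fun_lt_imp_dist_val_lt)
  qed
  then obtain g where "uniform_limit UNIV (\<lambda>n. apply_bcontfun (f n)) g sequentially"
    using Cauchy_uniformly_convergent[of UNIV "\<lambda>n. apply_bcontfun (f n)"]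
    unfolding uniformly_convergent_on_def by blast
  then obtain l where "f \<longlonglongrightarrow> l"
    by (rule uniform_limit_bcontfunE) simp_all
  then show "\<exists>l\<in>UNIV. f \<longlonglongrightarrow> l" by blast
qed

lemma banach_space_on_complete_subspace:
  fixes V :: "'b::real_normed_vector set"
  assumes "subspace V" "complete V"
  shows "banach_space_on V norm"
  unfolding banach_space_on_def
proof (intro conjI allI impI)
  show "normed_space_on V norm"
    using assms by (auto simp: normed_space_on_def norm_triangle_ineq)
next
  fix s :: "nat \<Rightarrow> 'b"
  assume s: "(\<forall>n. s n \<in> V) \<and> (\<forall>e>0. \<exists>M. \<forall>m\<ge>M. \<forall>n\<ge>M. norm (s m - s n) < e)"
  then have "Cauchy s" by (auto simp: Cauchy_iff)
  then obtain l where "l \<in> V" and l: "s \<longlonglongrightarrow> l"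
    using s assms(2) unfolding complete_def by blast
  show "\<exists>l\<in>V. (\<lambda>n. norm (s n - l)) \<longlonglongrightarrow> 0"
    using \<open>l \<in> V\<close> by (intro bexI[of _ l]) (use l in \<open>simp_all add: tendsto_norm_zero_iff LIM_zero_iff\<close>)
qed

section \<open>Compactness of coefficient spheres and finite representability of the limit\<close>

lemma normalized_coeffs_convergent_subseq:
  fixes a :: "nat \<Rightarrow> 'i \<Rightarrow> real"
  assumes B: "finite B" and a: "\<And>n. (\<Sum>b\<in>B. \<bar>a n b\<bar>) = 1"
  obtains s l where "strict_mono (s :: nat \<Rightarrow> nat)"
    "\<And>b. b \<in> B \<Longrightarrow> (\<lambda>n. a (s n) b) \<longlonglongrightarrow> l b" "(\<Sum>b\<in>B. \<bar>l b\<bar>) = 1"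
proof -
  have bnd: "norm (a n b) \<le> 1" if "b \<in> B" for n b
    using member_le_sum[of b B "\<lambda>b. \<bar>a n b\<bar>"] that B a[of n] by auto
  obtain s where s: "strict_mono (s :: nat \<Rightarrow> nat)"
    and "\<And>b. b \<in> B \<Longrightarrow> \<exists>l. (\<lambda>n. a (s n) b) \<longlonglongrightarrow> l"
    by (rule function_convergent_subsequence[where S = B and f = a and M = 1])
      (use bnd B in \<open>auto intro: countable_finite\<close>)
  then obtain l where l: "\<And>b. b \<in> B \<Longrightarrow> (\<lambda>n. a (s n) b) \<longlonglongrightarrow> l b" by metis
  have "(\<lambda>n. \<Sum>b\<in>B. \<bar>a (s n) b\<bar>) \<longlonglongrightarrow> (\<Sum>b\<in>B. \<bar>l b\<bar>)"
    by (intro tendsto_intros l)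
  then have "(\<Sum>b\<in>B. \<bar>l b\<bar>) = 1" unfolding a using LIMSEQ_const_iff by metis
  with s l show thesis using that by blast
qed

text \<open>Were there no such constant, coefficients normalized to absolute sum 1 would have
  arbitrarily small combinations. A limit point of them still has absolute sum 1 but gives a
  vanishing combination, against independence.\<close>

lemma independent_coeffs_bounded:
  fixes B :: "'b::real_normed_vector set"
  assumes B: "finite B" "independent B"
  obtains \<kappa> where "\<kappa> > 0" "\<And>a. (\<Sum>b\<in>B. \<bar>a b\<bar>) \<le> \<kappa> * norm (\<Sum>b\<in>B. a b *\<^sub>R b)"
proof (rule ccontr)
  assume contra: "\<not> thesis"
  have "\<exists>a. real (Suc n) * norm (\<Sum>b\<in>B. a b *\<^sub>R b) < (\<Sum>b\<in>B. \<bar>a b\<bar>)" for n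
  proof (rule ccontr)
    assume "\<not> ?thesis"
    then have le: "(\<Sum>b\<in>B. \<bar>a b\<bar>) \<le> real (Suc n) * norm (\<Sum>b\<in>B. a b *\<^sub>R b)" for a
      by (simp add: not_less)
    have thesis by (rule that[OF _ le]) simp
    with contra show False by contradiction
  qed
  then have "\<forall>n. \<exists>a. real (Suc n) * norm (\<Sum>b\<in>B. a b *\<^sub>R b) < (\<Sum>b\<in>B. \<bar>a b\<bar>)"
    by (rule allI)
  from choice[OF this] obtain a
    where a: "\<And>n. real (Suc n) * norm (\<Sum>b\<in>B. a n b *\<^sub>R b) < (\<Sum>b\<in>B. \<bar>a n b\<bar>)"
    by blast
  define t where "t n = (\<Sum>b\<in>B. \<bar>a n b\<bar>)" for n
  have t: "0 < t n" for n
    unfolding t_def by (rule le_less_trans[OF _ a[of n]]) auto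
  define c where "c n b = a n b / t n" for n b
  have c1: "(\<Sum>b\<in>B. \<bar>c n b\<bar>) = 1" for n
    using t[of n] by (simp add: c_def sum_divide_distrib[symmetric] t_def[symmetric])
  obtain s l where s: "strict_mono (s :: nat \<Rightarrow> nat)"
    and l: "\<And>b. b \<in> B \<Longrightarrow> (\<lambda>n. c (s n) b) \<longlonglongrightarrow> l b" and l1: "(\<Sum>b\<in>B. \<bar>l b\<bar>) = 1"
    by (rule normalized_coeffs_convergent_subseq[where a = c, OF B(1) c1]) (rule that)
  have small: "norm (\<Sum>b\<in>B. c n b *\<^sub>R b) \<le> inverse (real (Suc n))" for n
  proof -
    have "(\<Sum>b\<in>B. c n b *\<^sub>R b) = inverse (t n) *\<^sub>R (\<Sum>b\<in>B. a n b *\<^sub>R b)"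
      by (simp add: c_def scaleR_sum_right divide_inverse mult.commute)
    then have "norm (\<Sum>b\<in>B. c n b *\<^sub>R b) = norm (\<Sum>b\<in>B. a n b *\<^sub>R b) / t n"
      using t[of n] by (simp add: divide_inverse mult.commute)
    also have "\<dots> \<le> (t n / real (Suc n)) / t n"
    proof (rule divide_right_mono)
      show "norm (\<Sum>b\<in>B. a n b *\<^sub>R b) \<le> t n / real (Suc n)"
        using a[of n] by (simp add: t_def pos_le_divide_eq mult.commute del: of_nat_Suc)
    qed (use t[of n] in simp)
    also have "\<dots> = inverse (real (Suc n))"
      using t[of n] by (simp add: inverse_eq_divide del: of_nat_Suc)
    finally show ?thesis .
  qed
  have "(\<lambda>n. norm (\<Sum>b\<in>B. c n b *\<^sub>R b)) \<longlonglongrightarrow> 0"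
    by (rule Lim_null_comparison[OF _ LIMSEQ_inverse_real_of_nat]) (use small in auto)
  then have "(\<lambda>n. \<Sum>b\<in>B. c n b *\<^sub>R b) \<longlonglongrightarrow> 0" by (simp add: tendsto_norm_zero_iff)
  then have "(\<lambda>n. \<Sum>b\<in>B. c (s n) b *\<^sub>R b) \<longlonglongrightarrow> 0"
    using LIMSEQ_subseq_LIMSEQ[OF _ s, unfolded o_def] by blast
  moreover have "(\<lambda>n. \<Sum>b\<in>B. c (s n) b *\<^sub>R b) \<longlonglongrightarrow> (\<Sum>b\<in>B. l b *\<^sub>R b)"
    by (intro tendsto_intros l)
  ultimately have "(\<Sum>b\<in>B. l b *\<^sub>R b) = 0" using LIMSEQ_unique by blast
  then have "\<And>b. b \<in> B \<Longrightarrow> l b = 0"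
    using independentD[OF B(2) B(1) subset_refl, of l] by blast
  with l1 show False by simp
qed

text \<open>Convergence for each fixed coefficient family becomes uniform by compactness of the
  sphere of absolute sum 1: along a convergent subsequence of bad coefficients, the bound
  \<open>W\<close> permits replacing them by their limit. One index \<open>n\<close> valid for all
  coefficients is what a single linear embedding requires.\<close>

lemma norm_combination_uniform_limit:
  fixes w :: "nat \<Rightarrow> 'i \<Rightarrow> 'a::real_normed_vector" and v :: "'i \<Rightarrow> 'b::real_normed_vector"
  assumes B: "finite B" and w: "\<And>n b. b \<in> B \<Longrightarrow> norm (w n b) \<le> W"
    and lim: "\<And>a. (\<lambda>n. norm (\<Sum>b\<in>B. a b *\<^sub>R w n b)) \<longlonglongrightarrow> norm (\<Sum>b\<in>B. a b *\<^sub>R v b)"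
    and \<delta>: "0 < \<delta>"
  obtains n where "\<And>a. \<bar>norm (\<Sum>b\<in>B. a b *\<^sub>R w n b) - norm (\<Sum>b\<in>B. a b *\<^sub>R v b)\<bar>
    \<le> \<delta> * (\<Sum>b\<in>B. \<bar>a b\<bar>)"
proof (rule ccontr)
  define \<Delta> where "\<Delta> n a = \<bar>norm (\<Sum>b\<in>B. a b *\<^sub>R w n b) - norm (\<Sum>b\<in>B. a b *\<^sub>R v b)\<bar>" for n a
  assume contra: "\<not> thesis"
  have "\<exists>a. \<delta> * (\<Sum>b\<in>B. \<bar>a b\<bar>) < \<Delta> n a" for n
  proof (rule ccontr)
    assume "\<not> ?thesis"
    then have le: "\<Delta> n a \<le> \<delta> * (\<Sum>b\<in>B. \<bar>a b\<bar>)" for a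
      by (simp add: not_less)
    have thesis by (rule that[OF le[unfolded \<Delta>_def]])
    with contra show False by contradiction
  qed
  then obtain a where a: "\<And>n. \<delta> * (\<Sum>b\<in>B. \<bar>a n b\<bar>) < \<Delta> n (a n)" by metis
  define t where "t n = (\<Sum>b\<in>B. \<bar>a n b\<bar>)" for n
  have t: "0 < t n" for n
  proof (rule ccontr)
    assume "\<not> 0 < t n"
    moreover have "0 \<le> t n" unfolding t_def by (rule sum_nonneg) simp
    ultimately have t0: "t n = 0" by simp
    then have "\<And>b. b \<in> B \<Longrightarrow> a n b = 0" using B unfolding t_def by (simp add: sum_nonneg_eq_0_iff)
    then have "\<Delta> n (a n) = 0" by (simp add: \<Delta>_def)
    with a[of n] t0 show False by (simp add: t_def)
  qed
  define c where "c n b = a n b / t n" for n b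
  have c1: "(\<Sum>b\<in>B. \<bar>c n b\<bar>) = 1" for n
    using t[of n] by (simp add: c_def sum_divide_distrib[symmetric] t_def[symmetric])
  have big: "\<delta> < \<Delta> n (c n)" for n
  proof -
    have 1: "(\<Sum>b\<in>B. c n b *\<^sub>R u b) = inverse (t n) *\<^sub>R (\<Sum>b\<in>B. a n b *\<^sub>R u b)"
      for u :: "'i \<Rightarrow> 'c::real_normed_vector"
      by (simp add: c_def scaleR_sum_right divide_inverse mult.commute)
    have "\<Delta> n (c n) = inverse (t n) * \<Delta> n (a n)"
      unfolding \<Delta>_def 1 using t[of n]
      by (simp add: right_diff_distrib[symmetric] abs_mult del: mult_minus_right)
    moreover have "\<delta> * t n < \<Delta> n (a n)" using a[of n] by (simp add: t_def)
    ultimately show ?thesis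
      using t[of n] by (simp add: inverse_eq_divide pos_less_divide_eq)
  qed
  obtain s l where s: "strict_mono (s :: nat \<Rightarrow> nat)"
    and l: "\<And>b. b \<in> B \<Longrightarrow> (\<lambda>n. c (s n) b) \<longlonglongrightarrow> l b"
    by (rule normalized_coeffs_convergent_subseq[where a = c, OF B c1]) (rule that)
  have null: "(\<lambda>n. norm (\<Sum>b\<in>B. (c (s n) b - l b) *\<^sub>R w (s n) b)) \<longlonglongrightarrow> 0"
  proof (rule Lim_null_comparison)
    show "\<forall>\<^sub>F n in sequentially. norm (norm (\<Sum>b\<in>B. (c (s n) b - l b) *\<^sub>R w (s n) b))
        \<le> (\<Sum>b\<in>B. \<bar>c (s n) b - l b\<bar> * W)"
    proof (rule always_eventually, rule allI)
      fix n
      show "norm (norm (\<Sum>b\<in>B. (c (s n) b - l b) *\<^sub>R w (s n) b))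
        \<le> (\<Sum>b\<in>B. \<bar>c (s n) b - l b\<bar> * W)"
        by (simp, rule sum_norm_le) (simp add: w mult_left_mono)
    qed
    have "(\<lambda>n. \<Sum>b\<in>B. \<bar>c (s n) b - l b\<bar> * W) \<longlonglongrightarrow> (\<Sum>b\<in>B. \<bar>l b - l b\<bar> * W)"
      by (intro tendsto_intros l)
    then show "(\<lambda>n. \<Sum>b\<in>B. \<bar>c (s n) b - l b\<bar> * W) \<longlonglongrightarrow> 0" by simp
  qed
  have l_lim: "(\<lambda>n. norm (\<Sum>b\<in>B. l b *\<^sub>R w (s n) b)) \<longlonglongrightarrow> norm (\<Sum>b\<in>B. l b *\<^sub>R v b)"
    using LIMSEQ_subseq_LIMSEQ[OF lim s, unfolded o_def] .
  have "(\<lambda>n. norm (\<Sum>b\<in>B. c (s n) b *\<^sub>R w (s n) b) - norm (\<Sum>b\<in>B. l b *\<^sub>R w (s n) b)) \<longlonglongrightarrow> 0"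
    using norm_triangle_ineq3
    by (intro Lim_null_comparison[OF _ null] always_eventually allI)
      (simp add: sum_subtractf scaleR_left_diff_distrib)
  from tendsto_add[OF this l_lim]
  have "(\<lambda>n. norm (\<Sum>b\<in>B. c (s n) b *\<^sub>R w (s n) b)) \<longlonglongrightarrow> norm (\<Sum>b\<in>B. l b *\<^sub>R v b)" by simp
  moreover have "(\<lambda>n. norm (\<Sum>b\<in>B. c (s n) b *\<^sub>R v b)) \<longlonglongrightarrow> norm (\<Sum>b\<in>B. l b *\<^sub>R v b)"
    by (intro tendsto_intros l)
  ultimately have "(\<lambda>n. \<Delta> (s n) (c (s n))) \<longlonglongrightarrow> \<bar>norm (\<Sum>b\<in>B. l b *\<^sub>R v b) - norm (\<Sum>b\<in>B. l b *\<^sub>R v b)\<bar>"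
    unfolding \<Delta>_def by (intro tendsto_rabs tendsto_diff)
  then have "\<delta> \<le> 0"
    using big by (intro LIMSEQ_le_const[where X = "\<lambda>n. \<Delta> (s n) (c (s n))"]) (auto intro: less_imp_le)
  with \<delta> show False by simp
qed

text \<open>Coefficients vanishing from \<open>M\<close> on allow finitely many expansions to be
  padded to a common length.\<close>

lemma span_range_coeffs:
  fixes e :: "nat \<Rightarrow> 'b::real_vector"
  assumes "y \<in> span (range e)"
  shows "\<exists>M. \<exists>a :: nat \<Rightarrow> real. (\<forall>m\<ge>M. a m = 0) \<and> y = (\<Sum>m<M. a m *\<^sub>R e m)"
  using assms
proof (induction rule: span_induct_alt)
  case base
  show ?case by (rule exI[of _ 0], rule exI[of _ "\<lambda>_. 0"]) simp
next
  case (step c x y)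
  then obtain M a i where a: "\<forall>m\<ge>M. a m = 0" "y = (\<Sum>m<M. a m *\<^sub>R e m)" and i: "x = e i" by blast
  define N where "N = max M (Suc i)"
  define b where "b m = a m + (if m = i then c else 0)" for m
  have "(\<Sum>m<N. b m *\<^sub>R e m) = (\<Sum>m<N. a m *\<^sub>R e m) + (\<Sum>m<N. if m = i then c *\<^sub>R e m else 0)"
    unfolding sum.distrib[symmetric] b_def by (rule sum.cong) (auto simp: scaleR_left_distrib)
  also have "(\<Sum>m<N. a m *\<^sub>R e m) = y"
    unfolding a(2) by (rule sum.mono_neutral_right) (auto simp: N_def a(1))
  also have "(\<Sum>m<N. if m = i then c *\<^sub>R e m else 0) = c *\<^sub>R x"
    by (simp add: N_def i less_max_iff_disj)
  finally have "c *\<^sub>R x + y = (\<Sum>m<N. b m *\<^sub>R e m)" by (simp add: add.commute)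
  moreover have "\<forall>m\<ge>N. b m = 0" using a(1) by (auto simp: b_def N_def)
  ultimately show ?case by blast
qed

text \<open>A basis of \<open>span S\<close> lies only in the closure, so each basis vector
  \<open>b\<close> is approximated by a finite combination \<open>v b\<close> of the
  \<open>e m\<close>, and \<open>T\<close> sends \<open>b\<close> to a multiple of the same
  combination \<open>w n b\<close> of the \<open>x n m\<close>. The coefficient bound
  \<open>\<kappa>\<close> turns both errors into a small multiple of the norm.\<close>

lemma finitely_representable_limit_space:
  fixes x :: "nat \<Rightarrow> nat \<Rightarrow> 'a::real_normed_vector" and e :: "nat \<Rightarrow> 'b::real_normed_vector"
  assumes x: "\<And>n m. norm (x n m) \<le> 1"
    and lim: "\<And>M a. (\<lambda>n. norm (\<Sum>m<M. a m *\<^sub>R x n m)) \<longlonglongrightarrow> norm (\<Sum>m<M. a m *\<^sub>R e m)"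
  shows "finitely_representable (closure (span (range e))) norm TYPE('a)"
  unfolding finitely_representable_def
proof (intro allI impI)
  fix S :: "'b set" and \<epsilon> :: real
  assume S: "finite S \<and> S \<subseteq> closure (span (range e)) \<and> 0 < \<epsilon>"
  obtain B where B: "B \<subseteq> S" "independent B" "S \<subseteq> span B"
    using maximal_independent_subset by blast
  have finB: "finite B" using B S finite_subset by blast
  have spanB: "span S = span B"
    using B by (simp add: span_eq span_superset subset_trans[OF B(1)])
  obtain \<kappa> where \<kappa>: "\<kappa> > 0" "\<And>a. (\<Sum>b\<in>B. \<bar>a b\<bar>) \<le> \<kappa> * norm (\<Sum>b\<in>B. a b *\<^sub>R b)"
    using independent_coeffs_bounded[OF finB B(2)] by blast
  \<comment> \<open>\<open>d\<close> solves \<open>(1 + d) / (1 - d) = 1 + \<epsilon>\<close>: norms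
    will be distorted by factors between \<open>1 - d\<close> and \<open>1 + d\<close>, and
    \<open>T\<close> is rescaled by \<open>1 / (1 - d)\<close> to be norm-increasing. The factor 2
    in \<open>\<delta>\<close> shares \<open>d\<close> between the two errors, \<open>w n\<close>
    against \<open>v\<close> and \<open>v\<close> against the basis.\<close>
  define d where "d = \<epsilon> / (2 + \<epsilon>)"
  define \<delta> where "\<delta> = d / (2 * \<kappa>)"
  have d: "0 < d" "d < 1" "1 + d \<le> (1 + \<epsilon>) * (1 - d)"
    using S by (auto simp: d_def field_simps)
  have \<delta>: "0 < \<delta>" using d \<kappa> by (simp add: \<delta>_def)
  have "\<exists>M. \<exists>a :: nat \<Rightarrow> real. (\<forall>m\<ge>M. a m = 0) \<and> norm ((\<Sum>m<M. a m *\<^sub>R e m) - b) < \<delta>" if "b \<in> B" for b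
  proof -
    have "b \<in> closure (span (range e))" using that B S by blast
    then obtain y where "y \<in> span (range e)" "dist y b < \<delta>"
      using \<delta> unfolding closure_approachable by blast
    then show ?thesis using span_range_coeffs by (metis dist_norm)
  qed
  then obtain len \<alpha> where \<alpha>: "\<And>b m. b \<in> B \<Longrightarrow> len b \<le> m \<Longrightarrow> \<alpha> b m = (0::real)"
    "\<And>b. b \<in> B \<Longrightarrow> norm ((\<Sum>m<len b. \<alpha> b m *\<^sub>R e m) - b) < \<delta>"
    by metis
  define M where "M = (\<Sum>b\<in>B. len b)"
  have M: "len b \<le> M" if "b \<in> B" for b
    unfolding M_def using that finB by (intro member_le_sum) auto
  define v where "v b = (\<Sum>m<M. \<alpha> b m *\<^sub>R e m)" for b
  define w where "w n b = (\<Sum>m<M. \<alpha> b m *\<^sub>R x n m)" for n b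
  have v: "norm (v b - b) \<le> \<delta>" if "b \<in> B" for b
  proof -
    have "v b = (\<Sum>m<len b. \<alpha> b m *\<^sub>R e m)"
      unfolding v_def using M[OF that] \<alpha>(1)[OF that] by (intro sum.mono_neutral_right) auto
    then show ?thesis using \<alpha>(2)[OF that] by simp
  qed
  have combine: "(\<Sum>b\<in>B. a b *\<^sub>R (\<Sum>m<M. \<alpha> b m *\<^sub>R u m)) = (\<Sum>m<M. (\<Sum>b\<in>B. a b * \<alpha> b m) *\<^sub>R u m)"
    for a and u :: "nat \<Rightarrow> 'c::real_normed_vector"
    by (simp add: scaleR_sum_right scaleR_sum_left) (rule sum.swap)
  have w: "norm (w n b) \<le> (\<Sum>b\<in>B. \<Sum>m<M. \<bar>\<alpha> b m\<bar>)" if "b \<in> B" for n b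
  proof -
    have "norm (w n b) \<le> (\<Sum>m<M. \<bar>\<alpha> b m\<bar>)"
      unfolding w_def by (rule sum_norm_le) (simp add: x mult_left_le)
    also have "\<dots> \<le> (\<Sum>b\<in>B. \<Sum>m<M. \<bar>\<alpha> b m\<bar>)"
      using that finB by (intro member_le_sum[where f = "\<lambda>b. \<Sum>m<M. \<bar>\<alpha> b m\<bar>"]) (auto intro: sum_nonneg)
    finally show ?thesis .
  qed
  obtain n where n: "\<And>a. \<bar>norm (\<Sum>b\<in>B. a b *\<^sub>R w n b) - norm (\<Sum>b\<in>B. a b *\<^sub>R v b)\<bar>
      \<le> \<delta> * (\<Sum>b\<in>B. \<bar>a b\<bar>)"
    by (rule norm_combination_uniform_limit[where w = w and v = v, OF finB w _ \<delta>])
      (auto simp: w_def v_def combine lim)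
  have close: "\<bar>norm (\<Sum>b\<in>B. a b *\<^sub>R w n b) - norm (\<Sum>b\<in>B. a b *\<^sub>R b)\<bar>
      \<le> d * norm (\<Sum>b\<in>B. a b *\<^sub>R b)" for a
  proof -
    have "norm ((\<Sum>b\<in>B. a b *\<^sub>R v b) - (\<Sum>b\<in>B. a b *\<^sub>R b)) \<le> (\<Sum>b\<in>B. \<bar>a b\<bar> * \<delta>)"
      unfolding sum_subtractf[symmetric] scaleR_right_diff_distrib[symmetric]
      by (rule sum_norm_le) (simp add: v mult_left_mono)
    then have "\<bar>norm (\<Sum>b\<in>B. a b *\<^sub>R v b) - norm (\<Sum>b\<in>B. a b *\<^sub>R b)\<bar> \<le> \<delta> * (\<Sum>b\<in>B. \<bar>a b\<bar>)"
      using norm_triangle_ineq3[of "\<Sum>b\<in>B. a b *\<^sub>R v b" "\<Sum>b\<in>B. a b *\<^sub>R b"]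
      by (simp add: sum_distrib_left mult.commute)
    then have "\<bar>norm (\<Sum>b\<in>B. a b *\<^sub>R w n b) - norm (\<Sum>b\<in>B. a b *\<^sub>R b)\<bar> \<le> 2 * \<delta> * (\<Sum>b\<in>B. \<bar>a b\<bar>)"
      using n[of a] by linarith
    also have "\<dots> \<le> 2 * \<delta> * (\<kappa> * norm (\<Sum>b\<in>B. a b *\<^sub>R b))"
      using \<kappa>(2)[of a] \<delta> by (intro mult_left_mono) auto
    also have "\<dots> = d * norm (\<Sum>b\<in>B. a b *\<^sub>R b)"
      using \<kappa>(1) by (simp add: \<delta>_def)
    finally show ?thesis .
  qed
  obtain T where T: "linear T" "\<And>b. b \<in> B \<Longrightarrow> T b = (1 / (1 - d)) *\<^sub>R w n b"
    using linear_independent_extend[OF B(2), of "\<lambda>b. (1 / (1 - d)) *\<^sub>R w n b"] by blast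
  have "norm y \<le> norm (T y) \<and> norm (T y) \<le> (1 + \<epsilon>) * norm y" if "y \<in> span S" for y
  proof -
    from that have "y \<in> range (\<lambda>a. \<Sum>b\<in>B. a b *\<^sub>R b)"
      unfolding spanB span_finite[OF finB] .
    then obtain a where y: "y = (\<Sum>b\<in>B. a b *\<^sub>R b)" by blast
    have "T y = (1 / (1 - d)) *\<^sub>R (\<Sum>b\<in>B. a b *\<^sub>R w n b)"
      unfolding y linear_sum[OF T(1)] scaleR_sum_right
      by (rule sum.cong) (auto simp: linear_scale[OF T(1)] T(2))
    then have Ty: "norm (T y) = norm (\<Sum>b\<in>B. a b *\<^sub>R w n b) / (1 - d)"
      using d by simp
    have c: "\<bar>norm (\<Sum>b\<in>B. a b *\<^sub>R w n b) - norm y\<bar> \<le> d * norm y"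
      using close[of a] by (simp add: y)
    have "norm y * (1 - d) \<le> norm (\<Sum>b\<in>B. a b *\<^sub>R w n b)"
      using c by (simp add: algebra_simps abs_le_iff)
    moreover have "norm (\<Sum>b\<in>B. a b *\<^sub>R w n b) \<le> ((1 + \<epsilon>) * norm y) * (1 - d)"
    proof -
      have "norm (\<Sum>b\<in>B. a b *\<^sub>R w n b) \<le> (1 + d) * norm y"
        using c by (simp add: algebra_simps abs_le_iff)
      also have "\<dots> \<le> ((1 + \<epsilon>) * (1 - d)) * norm y"
        using d(3) by (intro mult_right_mono) auto
      finally show ?thesis by (simp add: mult_ac)
    qed
    ultimately show ?thesis using d(2) by (simp add: Ty field_simps)
  qed
  with T(1) show "\<exists>T :: 'b \<Rightarrow> 'a. linear T \<and>
      (\<forall>y\<in>span S. norm y \<le> norm (T y) \<and> norm (T y) \<le> (1 + \<epsilon>) * norm y)" by blast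
qed

section \<open>Slices and reflexivity\<close>

text \<open>The points where \<open>\<psi>\<close> comes within \<open>a\<close> of its supremum
  over \<open>T\<close>. Comparison with the points of \<open>T\<close> instead of the supremum
  reduces inclusions of slices to pointwise inequalities.\<close>

definition slice :: "'b set \<Rightarrow> ('b \<Rightarrow> real) \<Rightarrow> real \<Rightarrow> 'b set" where
  "slice T \<psi> a = {x \<in> T. \<forall>t\<in>T. \<psi> t - a < \<psi> x}"

definition is_slice :: "'b::real_normed_vector set \<Rightarrow> 'b set \<Rightarrow> bool" where
  "is_slice T K \<longleftrightarrow> (\<exists>\<psi> a M. linear \<psi> \<and> (\<forall>v. \<bar>\<psi> v\<bar> \<le> M * norm v) \<and> 0 < a \<and> K = slice T \<psi> a)"

lemma slice_nonempty:
  assumes "T \<noteq> {}" "bdd_above (\<psi> ` T)" "0 < a"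
  shows "slice T \<psi> a \<noteq> {}"
proof -
  have "Sup (\<psi> ` T) - a < Sup (\<psi> ` T)" using assms by simp
  then obtain x where x: "x \<in> T" "Sup (\<psi> ` T) - a < \<psi> x"
    using assms by (subst (asm) less_cSup_iff) auto
  moreover have "\<psi> t \<le> Sup (\<psi> ` T)" if "t \<in> T" for t
    using that assms by (intro cSup_upper) auto
  ultimately have "x \<in> slice T \<psi> a" unfolding slice_def by force
  then show ?thesis by blast
qed

lemma linear_bdd_above_image:
  fixes T :: "'b::real_normed_vector set"
  assumes "\<And>v. \<bar>\<psi> v\<bar> \<le> M * norm v" "\<And>t. t \<in> T \<Longrightarrow> norm t \<le> 1"
  shows "bdd_above (\<psi> ` T)"
proof (rule bdd_aboveI2)
  fix t assume t: "t \<in> T"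
  have "\<psi> t \<le> M * norm t" using assms(1)[of t] by linarith
  also have "\<dots> \<le> \<bar>M\<bar> * 1" using assms(2)[OF t] by (intro mult_mono) auto
  finally show "\<psi> t \<le> \<bar>M\<bar>" by simp
qed

text \<open>A near maximizer of \<open>\<psi>\<close> is the midpoint of two
  \<open>\<epsilon>\<close>-separated near maximizers, one of which is at distance at least
  \<open>\<epsilon> / 2\<close> from \<open>y\<close>. Perturbing \<open>\<psi>\<close> by a
  functional norming the difference to \<open>y\<close> cuts out the new slice. One functional
  separates all of that slice from \<open>y\<close>; unlike a lower bound on distances, this
  survives weak limits.\<close>

lemma slice_refine_away_from_point:
  fixes T :: "'b::real_normed_vector set"
  assumes T: "T \<noteq> {}" "\<And>t. t \<in> T \<Longrightarrow> norm t \<le> 1"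
    and \<epsilon>: "0 < \<epsilon>"
    and mid: "\<And>t. t \<in> T \<Longrightarrow> \<exists>p\<in>T. \<exists>q\<in>T. t = (1 / 2) *\<^sub>R (p + q) \<and> \<epsilon> \<le> norm (p - q)"
    and K: "is_slice T K"
  shows "\<exists>K'. is_slice T K' \<and> K' \<subseteq> K \<and>
    (\<exists>\<phi>. linear \<phi> \<and> (\<forall>v. \<bar>\<phi> v\<bar> \<le> norm v) \<and> (\<forall>x\<in>K'. \<epsilon> / 4 \<le> \<phi> (x - y)))"
proof -
  obtain \<psi> a M where \<psi>: "linear \<psi>" "\<And>v. \<bar>\<psi> v\<bar> \<le> M * norm v" and a: "0 < a" and K: "K = slice T \<psi> a"
    using K unfolding is_slice_def by blast
  \<comment> \<open>Points of the new slice lose less than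
    \<open>2 * b + 2 * l \<le> 3 * a / 4\<close> in \<open>\<psi>\<close>, hence stay in
    \<open>K\<close>, and less than \<open>2 * b / l \<le> \<epsilon> / 4\<close> in
    \<open>\<phi>\<close>.\<close>
  define l where "l = a / 8"
  define b where "b = min (a / 4) (l * \<epsilon> / 8)"
  have l: "0 < l" and b: "0 < b" "b \<le> a / 4" "b \<le> l * \<epsilon> / 8"
    using a \<epsilon> by (auto simp: l_def b_def)
  \<comment> \<open>Half of \<open>b\<close>, because the deficit can double on passing from a
    midpoint to its endpoints.\<close>
  have "slice T \<psi> (b / 2) \<noteq> {}"
    using T(1) linear_bdd_above_image[OF \<psi>(2) T(2)] b by (intro slice_nonempty) auto
  then obtain t where t: "t \<in> T" "\<And>s. s \<in> T \<Longrightarrow> \<psi> s - b / 2 < \<psi> t"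
    unfolding slice_def by blast
  obtain p q where pq: "p \<in> T" "q \<in> T" "t = (1 / 2) *\<^sub>R (p + q)" "\<epsilon> \<le> norm (p - q)"
    using mid[OF t(1)] by blast
  have "2 * \<psi> t = \<psi> p + \<psi> q"
    by (simp add: pq(3) linear_scale[OF \<psi>(1)] linear_add[OF \<psi>(1)])
  then have near: "\<psi> s - b < \<psi> p" "\<psi> s - b < \<psi> q" if "s \<in> T" for s
    using t(2)[OF that] t(2)[OF pq(1)] t(2)[OF pq(2)] by linarith+
  have "norm (p - q) \<le> norm (p - y) + norm (q - y)"
    using norm_triangle_ineq4[of "p - y" "q - y"] by simp
  then have "\<epsilon> / 2 \<le> norm (p - y) \<or> \<epsilon> / 2 \<le> norm (q - y)"
    using pq(4) by linarith
  then obtain c where c: "c \<in> T" "\<epsilon> / 2 \<le> norm (c - y)" "\<And>s. s \<in> T \<Longrightarrow> \<psi> s - b < \<psi> c"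
    using pq near by blast
  obtain \<phi> where \<phi>: "linear \<phi>" "\<And>v. \<bar>\<phi> v\<bar> \<le> norm v" "\<phi> (c - y) = norm (c - y)"
    using norming_functional[of "c - y"] by blast
  \<comment> \<open>As \<open>c\<close> nearly maximizes \<open>\<psi>\<close>, a near maximizer of the perturbed functional can lose little
    of \<open>\<phi> c\<close>, and it still nearly maximizes \<open>\<psi>\<close>.\<close>
  define \<psi>' where "\<psi>' v = \<psi> v + l * \<phi> v" for v
  have "linear \<psi>'"
    by (rule linearI)
      (simp_all add: \<psi>'_def linear_add[OF \<psi>(1)] linear_add[OF \<phi>(1)] linear_scale[OF \<psi>(1)]
        linear_scale[OF \<phi>(1)] algebra_simps)
  moreover have "\<bar>\<psi>' v\<bar> \<le> (M + l) * norm v" for v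
  proof -
    have "\<bar>\<psi>' v\<bar> \<le> \<bar>\<psi> v\<bar> + l * \<bar>\<phi> v\<bar>"
      unfolding \<psi>'_def using l by (simp add: abs_mult order_trans[OF abs_triangle_ineq])
    also have "\<dots> \<le> M * norm v + l * norm v"
      using \<psi>(2) \<phi>(2) l by (intro add_mono mult_left_mono) auto
    finally show ?thesis by (simp add: algebra_simps)
  qed
  ultimately have "is_slice T (slice T \<psi>' b)"
    unfolding is_slice_def using b(1) by blast
  moreover have "x \<in> K \<and> \<epsilon> / 4 \<le> \<phi> (x - y)" if "x \<in> slice T \<psi>' b" for x
  proof -
    have x: "x \<in> T" "\<psi> c + l * \<phi> c - b < \<psi> x + l * \<phi> x"
      using that c(1) by (auto simp: slice_def \<psi>'_def)
    have "l * (\<phi> c - \<phi> x) < 2 * b"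
      using x(2) c(3)[OF x(1)] by (simp add: algebra_simps)
    also have "\<dots> \<le> l * (\<epsilon> / 4)" using b(3) by simp
    finally have "\<phi> c - \<phi> x < \<epsilon> / 4" using l by simp
    then have "\<epsilon> / 4 \<le> \<phi> (x - y)"
      using \<phi>(3) c(2) by (simp add: linear_diff[OF \<phi>(1)])
    moreover have "\<psi> s - a < \<psi> x" if "s \<in> T" for s
    proof -
      have "\<bar>\<phi> c\<bar> \<le> 1" "\<bar>\<phi> x\<bar> \<le> 1"
        using \<phi>(2)[of c] \<phi>(2)[of x] T(2)[OF c(1)] T(2)[OF x(1)] by linarith+
      then have "l * (\<phi> x - \<phi> c) \<le> l * 2" using l by (intro mult_left_mono) auto
      then show ?thesis
        using x(2) c(3)[OF that] b(2) a by (simp add: l_def algebra_simps)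
    qed
    ultimately show ?thesis using x(1) by (simp add: K slice_def)
  qed
  ultimately show ?thesis using \<phi>(1,2) by blast
qed

section \<open>Dual functionals and weak limits in reflexive spaces\<close>

lemma dual_onI:
  assumes "\<And>x y. x \<in> V \<Longrightarrow> y \<in> V \<Longrightarrow> \<phi> (x + y) = \<phi> x + \<phi> y"
    "\<And>c x. x \<in> V \<Longrightarrow> \<phi> (c *\<^sub>R x) = c * \<phi> x"
    "\<And>x. x \<in> V \<Longrightarrow> \<bar>\<phi> x\<bar> \<le> B * N x" "\<And>x. x \<notin> V \<Longrightarrow> \<phi> x = 0"
  shows "\<phi> \<in> dual_on V N"
  unfolding dual_on_def using assms by blast

lemma dual_on_bound:
  "\<phi> \<in> dual_on V N \<Longrightarrow> \<exists>B. \<forall>v\<in>V. \<bar>\<phi> v\<bar> \<le> B * N v"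
  by (simp add: dual_on_def)

lemma dual_on_restrict:
  fixes V :: "'b::real_normed_vector set"
  assumes "subspace V" "linear \<phi>" "\<And>v. \<bar>\<phi> v\<bar> \<le> norm v"
  shows "(\<lambda>v. if v \<in> V then \<phi> v else 0) \<in> dual_on V norm"
  by (rule dual_onI[where B = 1])
    (use assms in \<open>auto simp: subspace_add subspace_scale linear_add linear_scale\<close>)

text \<open>Applying a generalized limit to \<open>\<phi> (z n)\<close> defines a functional of norm
  at most 1 on the dual; reflexivity represents it by a point \<open>x\<close>. Eventual lower
  bounds are inherited because the generalized limit respects them.\<close>

lemma reflexive_on_sequence_limit:
  fixes V :: "'b::real_normed_vector set"
  assumes V: "subspace V" and refl: "reflexive_on V norm"
    and z: "\<And>n. z n \<in> V" "\<And>n. norm (z n) \<le> 1"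
  obtains x where "x \<in> V"
    "\<And>\<phi> c. linear \<phi> \<Longrightarrow> (\<And>v. \<bar>\<phi> v\<bar> \<le> norm v) \<Longrightarrow> (\<forall>\<^sub>F n in sequentially. c \<le> \<phi> (z n)) \<Longrightarrow> c \<le> \<phi> x"
proof -
  from generalized_limit obtain L :: "(nat \<Rightarrow>\<^sub>C real) \<Rightarrow> real" where
    "linear L \<and> (\<forall>w c. (\<forall>\<^sub>F n in sequentially. apply_bcontfun w n \<le> c) \<longrightarrow> L w \<le> c)" ..
  then have L: "linear L"
    and L_le: "\<And>w c. (\<forall>\<^sub>F n in sequentially. apply_bcontfun w n \<le> c) \<Longrightarrow> L w \<le> c"
    by simp_all
  have L_ge: "c \<le> L w" if "\<forall>\<^sub>F n in sequentially. c \<le> apply_bcontfun w n" for w c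
    using L_le[of "- w" "- c"] that by (simp add: linear_neg[OF L] uminus_bcontfun.rep_eq)
  define W where "W \<phi> = Bcontfun (\<lambda>n. \<phi> (z n))" for \<phi> :: "'b \<Rightarrow> real"
  have dual_le: "\<bar>\<phi> (z n)\<bar> \<le> dual_norm_on V norm \<phi>" if \<phi>: "\<phi> \<in> dual_on V norm" for \<phi> n
  proof -
    from dual_on_bound[OF \<phi>] obtain B where B: "\<forall>v\<in>V. \<bar>\<phi> v\<bar> \<le> B * norm v" ..
    have "bdd_above ((\<lambda>v. \<bar>\<phi> v\<bar>) ` {v \<in> V. norm v \<le> 1})"
    proof (rule bdd_aboveI2)
      fix v assume v: "v \<in> {v \<in> V. norm v \<le> 1}"
      then have "\<bar>\<phi> v\<bar> \<le> B * norm v" using B by simp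
      also have "\<dots> \<le> \<bar>B\<bar> * 1" using v by (intro mult_mono) auto
      finally show "\<bar>\<phi> v\<bar> \<le> \<bar>B\<bar>" by simp
    qed
    then show ?thesis
      unfolding dual_norm_on_def using z by (intro cSUP_upper) auto
  qed
  have W: "apply_bcontfun (W \<phi>) n = \<phi> (z n)" if \<phi>: "\<phi> \<in> dual_on V norm" for \<phi> n
    unfolding W_def using dual_le[OF \<phi>]
    by (subst Bcontfun_inverse) (auto intro!: bcontfun_normI[where b = "dual_norm_on V norm \<phi>"])
  have plus: "(\<lambda>v. \<phi> v + \<psi> v) \<in> dual_on V norm" if "\<phi> \<in> dual_on V norm" "\<psi> \<in> dual_on V norm" for \<phi> \<psi>
  proof -
    from dual_on_bound[OF that(1)] obtain B where B: "\<forall>v\<in>V. \<bar>\<phi> v\<bar> \<le> B * norm v" ..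
    from dual_on_bound[OF that(2)] obtain B' where B': "\<forall>v\<in>V. \<bar>\<psi> v\<bar> \<le> B' * norm v" ..
    have "\<bar>\<phi> v + \<psi> v\<bar> \<le> (B + B') * norm v" if "v \<in> V" for v
      using bspec[OF B that] bspec[OF B' that] abs_triangle_ineq[of "\<phi> v" "\<psi> v"]
      by (simp add: distrib_right)
    then show ?thesis
      using that by (intro dual_onI[where B = "B + B'"]) (auto simp: dual_on_def algebra_simps)
  qed
  have times: "(\<lambda>v. r * \<phi> v) \<in> dual_on V norm" if "\<phi> \<in> dual_on V norm" for \<phi> r
  proof -
    from dual_on_bound[OF that] obtain B where B: "\<forall>v\<in>V. \<bar>\<phi> v\<bar> \<le> B * norm v" ..
    have "\<bar>r * \<phi> v\<bar> \<le> (\<bar>r\<bar> * B) * norm v" if "v \<in> V" for v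
      using mult_left_mono[OF bspec[OF B that], of "\<bar>r\<bar>"] by (simp add: abs_mult mult_ac)
    then show ?thesis
      using that by (intro dual_onI[where B = "\<bar>r\<bar> * B"]) (auto simp: dual_on_def algebra_simps)
  qed
  have "\<exists>x\<in>V. \<forall>\<phi>\<in>dual_on V norm. L (W \<phi>) = \<phi> x"
  proof (rule mp[OF spec[OF refl[unfolded reflexive_on_def], of "\<lambda>\<phi>. L (W \<phi>)"]],
      intro conjI ballI allI)
    fix \<phi> \<psi> assume *: "\<phi> \<in> dual_on V norm" "\<psi> \<in> dual_on V norm"
    have "W (\<lambda>x. \<phi> x + \<psi> x) = W \<phi> + W \<psi>"
      by (rule bcontfun_eqI) (simp add: W * plus plus_bcontfun.rep_eq)
    then show "L (W (\<lambda>x. \<phi> x + \<psi> x)) = L (W \<phi>) + L (W \<psi>)" by (simp add: linear_add[OF L])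
  next
    fix c \<phi> assume *: "\<phi> \<in> dual_on V norm"
    have "W (\<lambda>x. c * \<phi> x) = c *\<^sub>R W \<phi>"
      by (rule bcontfun_eqI) (simp add: W * times scaleR_bcontfun.rep_eq)
    then show "L (W (\<lambda>x. c * \<phi> x)) = c * L (W \<phi>)" by (simp add: linear_scale[OF L])
  next
    have "\<bar>L (W \<phi>)\<bar> \<le> 1 * dual_norm_on V norm \<phi>" if *: "\<phi> \<in> dual_on V norm" for \<phi>
    proof -
      have "- dual_norm_on V norm \<phi> \<le> \<phi> (z n)" "\<phi> (z n) \<le> dual_norm_on V norm \<phi>" for n
        using dual_le[OF *, of n] by linarith+
      then have "L (W \<phi>) \<le> dual_norm_on V norm \<phi>" "- dual_norm_on V norm \<phi> \<le> L (W \<phi>)"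
        using L_le[of "W \<phi>"] L_ge[of _ "W \<phi>"] by (simp_all add: W[OF *])
      then show ?thesis by linarith
    qed
    then show "\<exists>B. \<forall>\<phi>\<in>dual_on V norm. \<bar>L (W \<phi>)\<bar> \<le> B * dual_norm_on V norm \<phi>" by blast
  qed
  then obtain x where x: "x \<in> V" "\<forall>\<phi>\<in>dual_on V norm. L (W \<phi>) = \<phi> x" ..
  show thesis
  proof (rule that[OF x(1)])
    fix \<phi> :: "'b \<Rightarrow> real" and c
    assume \<phi>: "linear \<phi>" "\<And>v. \<bar>\<phi> v\<bar> \<le> norm v" and c: "\<forall>\<^sub>F n in sequentially. c \<le> \<phi> (z n)"
    \<comment> \<open>Members of \<open>dual_on\<close> vanish outside \<open>V\<close>; the
      truncation does not change the values at \<open>z n\<close> and \<open>x\<close>.\<close>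
    define \<phi>' where "\<phi>' v = (if v \<in> V then \<phi> v else 0)" for v
    have dual: "\<phi>' \<in> dual_on V norm"
      unfolding \<phi>'_def[abs_def] by (rule dual_on_restrict[OF V \<phi>])
    have "c \<le> L (W \<phi>')"
      using c by (intro L_ge) (simp add: W[OF dual] \<phi>'_def z)
    then show "c \<le> \<phi> x" using bspec[OF x(2) dual] x(1) by (simp add: \<phi>'_def)
  qed
qed

text \<open>
  All slices of \<open>T\<close> are large, so slices can be shrunk successively to avoid each point of a countable
  dense set. A weak limit of points from the shrinking slices then stays away from all of them.
\<close>

lemma reflexive_on_no_midpoint_bush:
  fixes V T :: "'b::real_normed_vector set"
  assumes V: "subspace V" and refl: "reflexive_on V norm"
    and dense: "\<And>v \<eta>. v \<in> V \<Longrightarrow> 0 < \<eta> \<Longrightarrow> \<exists>i::nat. norm (v - y i) < \<eta>"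
    and T: "T \<subseteq> V" "T \<noteq> {}" "\<And>t. t \<in> T \<Longrightarrow> norm t \<le> 1"
    and \<epsilon>: "0 < \<epsilon>"
    and mid: "\<And>t. t \<in> T \<Longrightarrow> \<exists>p\<in>T. \<exists>q\<in>T. t = (1 / 2) *\<^sub>R (p + q) \<and> \<epsilon> \<le> norm (p - q)"
  shows False
proof -
  have "\<exists>K. \<forall>n. is_slice T (K n) \<and> (K (Suc n) \<subseteq> K n \<and>
    (\<exists>\<phi>. linear \<phi> \<and> (\<forall>v. \<bar>\<phi> v\<bar> \<le> norm v) \<and> (\<forall>x\<in>K (Suc n). \<epsilon> / 4 \<le> \<phi> (x - y n))))"
  proof (rule dependent_nat_choice)
    \<comment> \<open>For the zero functional the slice is all of \<open>T\<close>, which starts the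
      chain.\<close>
    have "linear (\<lambda>v :: 'b. 0 :: real)" by (rule linearI) auto
    then have "is_slice T (slice T (\<lambda>v. 0) 1)"
      unfolding is_slice_def by (intro exI[of _ "\<lambda>v. 0"] exI[of _ 1] exI[of _ 0]) auto
    then show "\<exists>K. is_slice T K" by blast
  next
    fix K n assume "is_slice T K"
    from slice_refine_away_from_point[OF T(2,3) \<epsilon> mid this]
    show "\<exists>K'. is_slice T K' \<and> K' \<subseteq> K \<and>
      (\<exists>\<phi>. linear \<phi> \<and> (\<forall>v. \<bar>\<phi> v\<bar> \<le> norm v) \<and> (\<forall>x\<in>K'. \<epsilon> / 4 \<le> \<phi> (x - y n)))" .
  qed
  then obtain K where K: "\<And>n. is_slice T (K n)" "\<And>n. K (Suc n) \<subseteq> K n"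
    and away: "\<And>n. \<exists>\<phi>. linear \<phi> \<and> (\<forall>v. \<bar>\<phi> v\<bar> \<le> norm v) \<and> (\<forall>x\<in>K (Suc n). \<epsilon> / 4 \<le> \<phi> (x - y n))"
    by blast
  have "K n \<noteq> {}" for n
  proof -
    obtain \<psi> a M where "linear \<psi>" "\<And>v. \<bar>\<psi> v\<bar> \<le> M * norm v" "0 < a" "K n = slice T \<psi> a"
      using K(1)[of n] unfolding is_slice_def by blast
    then show ?thesis
      using slice_nonempty[OF T(2) linear_bdd_above_image[of \<psi> M T]] T(3) by simp
  qed
  then have "\<forall>n. \<exists>z. z \<in> K n" by blast
  then obtain z where z: "\<And>n. z n \<in> K n" by metis
  have KT: "K n \<subseteq> T" for n
    using K(1)[of n] by (auto simp: is_slice_def slice_def)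
  have zT: "z n \<in> T" for n using z KT by blast
  have anti: "K n \<subseteq> K m" if "m \<le> n" for m n
    using lift_Suc_antimono_le[of K, OF K(2) that] .
  obtain x where x: "x \<in> V"
    "\<And>\<phi> c. linear \<phi> \<Longrightarrow> (\<And>v. \<bar>\<phi> v\<bar> \<le> norm v) \<Longrightarrow> (\<forall>\<^sub>F n in sequentially. c \<le> \<phi> (z n)) \<Longrightarrow> c \<le> \<phi> x"
    by (rule reflexive_on_sequence_limit[OF V refl, of z]) (use zT T in auto)
  obtain i where i: "norm (x - y i) < \<epsilon> / 4" using dense[OF x(1), of "\<epsilon> / 4"] \<epsilon> by auto
  obtain \<phi> where \<phi>: "linear \<phi>" "\<And>v. \<bar>\<phi> v\<bar> \<le> norm v" "\<And>x. x \<in> K (Suc i) \<Longrightarrow> \<epsilon> / 4 \<le> \<phi> (x - y i)"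
    using away[of i] by blast
  have "\<epsilon> / 4 + \<phi> (y i) \<le> \<phi> (z n)" if "Suc i \<le> n" for n
    using \<phi>(3)[of "z n"] z[of n] anti[OF that] by (auto simp: linear_diff[OF \<phi>(1)])
  then have "\<forall>\<^sub>F n in sequentially. \<epsilon> / 4 + \<phi> (y i) \<le> \<phi> (z n)"
    unfolding eventually_sequentially by blast
  then have "\<epsilon> / 4 + \<phi> (y i) \<le> \<phi> x" by (rule x(2)[OF \<phi>(1,2)])
  then show False
    using i \<phi>(2)[of "x - y i"] by (simp add: linear_diff[OF \<phi>(1)])
qed

lemma countable_dense_closure_span:
  fixes e :: "nat \<Rightarrow> 'b::real_normed_vector"
  assumes e: "\<And>m. norm (e m) \<le> 1"
  obtains y :: "nat \<Rightarrow> 'b" where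
    "\<And>v \<eta>. v \<in> closure (span (range e)) \<Longrightarrow> 0 < \<eta> \<Longrightarrow> \<exists>k. norm (v - y k) < \<eta>"
proof -
  obtain len where len: "\<And>k m. len k \<le> m \<Longrightarrow> rat_coeff k m = 0"
    using rat_coeff_eventually_0 by metis
  define y where "y k = (\<Sum>m<len k. rat_coeff k m *\<^sub>R e m)" for k
  have "\<exists>k. norm (v - y k) < \<eta>" if v: "v \<in> closure (span (range e))" and \<eta>: "0 < \<eta>" for v \<eta>
  proof -
    obtain w where "w \<in> span (range e)" and w: "dist w v < \<eta> / 2"
      using v half_gt_zero[OF \<eta>] unfolding closure_approachable by blast
    then obtain M a where a: "w = (\<Sum>m<M. a m *\<^sub>R e m)" using span_range_coeffs by blast
    have "0 < \<eta> / (2 * (real M + 1))" using \<eta> by simp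
    then obtain k where k0: "\<And>m. m \<ge> M \<Longrightarrow> rat_coeff k m = 0"
      and k: "\<And>m. m < M \<Longrightarrow> \<bar>a m - rat_coeff k m\<bar> < \<eta> / (2 * (real M + 1))"
      using rat_coeff_dense by blast
    have "y k = (\<Sum>m<max M (len k). rat_coeff k m *\<^sub>R e m)"
      unfolding y_def by (rule sum.mono_neutral_left) (auto simp: len)
    also have "\<dots> = (\<Sum>m<M. rat_coeff k m *\<^sub>R e m)"
      by (rule sum.mono_neutral_right) (auto simp: k0)
    finally have "norm (w - y k) \<le> real M * (\<eta> / (2 * (real M + 1)))"
      unfolding a using k by (simp only:) (intro norm_combination_diff_le e less_imp_le)
    also have "\<dots> \<le> \<eta> / 2" using \<eta> by (simp add: field_simps)
    finally show ?thesis
      using w norm_triangle_ineq[of "v - w" "w - y k"]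
      by (intro exI[of _ k]) (simp add: dist_norm norm_minus_commute)
  qed
  then show thesis using that by blast
qed

section \<open>Dyadic trees of averages\<close>

text \<open>\<open>j\<close> is the scale, so in the tree it decreases from the root to the leaves;
  the children of node \<open>i\<close> are \<open>2 * i\<close> and \<open>Suc (2 * i)\<close> at
  the next smaller scale.\<close>

definition dyadic_avg :: "(nat \<Rightarrow> 'a::real_vector) \<Rightarrow> nat \<Rightarrow> nat \<Rightarrow> 'a" where
  "dyadic_avg u j i = (1 / 2 ^ j) *\<^sub>R sum u {i * 2 ^ j..<Suc i * 2 ^ j}"

lemma dyadic_avg_Suc:
  "dyadic_avg u (Suc j) i = (1 / 2) *\<^sub>R (dyadic_avg u j (2 * i) + dyadic_avg u j (Suc (2 * i)))"
proof -
  have "sum u {i * 2 ^ Suc j..<Suc i * 2 ^ Suc j}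
    = sum u {2 * i * 2 ^ j..<Suc (2 * i) * 2 ^ j} + sum u {Suc (2 * i) * 2 ^ j..<Suc (Suc (2 * i)) * 2 ^ j}"
    by (subst sum.atLeastLessThan_concat) (auto simp: mult_ac)
  then show ?thesis
    by (simp only: dyadic_avg_def) (simp add: scaleR_right_distrib)
qed

lemma norm_dyadic_avg_le:
  fixes u :: "nat \<Rightarrow> 'a::real_normed_vector"
  assumes "\<And>i. norm (u i) \<le> 1"
  shows "norm (dyadic_avg u j i) \<le> 1"
proof -
  have "norm (sum u {i * 2 ^ j..<Suc i * 2 ^ j}) \<le> real (card {i * 2 ^ j..<Suc i * 2 ^ j}) * 1"
    by (rule sum_norm_bound) (rule assms)
  then show ?thesis by (simp add: dyadic_avg_def)
qed

text \<open>Outside a block of length \<open>h\<close> the terms contribute at most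
  \<open>N - h\<close>, so the block has norm at least \<open>h - 1/2 \<ge> h/2\<close>. Domination
  bounds its distance to the next block below by \<open>h / (2 * C)\<close>, and averaging removes
  the factor \<open>h\<close>.\<close>

lemma dyadic_avg_separated:
  fixes u :: "nat \<Rightarrow> 'a::real_normed_vector"
  assumes u: "dominating C u" "\<And>i. norm (u i) \<le> 1" and C: "0 < C"
    and big: "real N - 1 / 2 < norm (\<Sum>i<N. u i)" and i: "Suc i * 2 ^ j \<le> N"
  shows "1 / (2 * C) \<le> norm (dyadic_avg u j i - dyadic_avg u j (Suc i))"
proof -
  define h :: real where "h = 2 ^ j"
  have h: "1 \<le> h" by (simp add: h_def)
  define I where "I = {i * 2 ^ j..<Suc i * 2 ^ j}"
  define J where "J = {Suc i * 2 ^ j..<Suc (Suc i) * 2 ^ j}"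
  have I: "I \<subseteq> {..<N}" "real (card I) = h" using i by (auto simp: I_def h_def)
  have "(\<Sum>i<N. u i) = sum u I + sum u ({..<N} - I)"
    using I by (simp add: sum.subset_diff[of I "{..<N}"] add.commute)
  also have "norm \<dots> \<le> norm (sum u I) + norm (sum u ({..<N} - I))"
    by (rule norm_triangle_ineq)
  also have "norm (sum u ({..<N} - I)) \<le> real (card ({..<N} - I)) * 1"
    by (rule sum_norm_bound) (rule u(2))
  also have "real (card ({..<N} - I)) = real N - h"
  proof -
    have "card I \<le> N" using card_mono[OF _ I(1)] by simp
    then show ?thesis using I finite_subset[OF I(1)] by (simp add: card_Diff_subset of_nat_diff)
  qed
  finally have "h / 2 \<le> norm (sum u I)" using big h by simp
  also have "\<dots> \<le> C * norm (sum u I - sum u J)"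
    unfolding I_def J_def by (rule dominatingD[OF u(1)]) auto
  finally have "1 / (2 * C) \<le> norm (sum u I - sum u J) / h"
    using h C by (simp add: field_simps)
  also have "\<dots> = norm (dyadic_avg u j i - dyadic_avg u j (Suc i))"
    unfolding dyadic_avg_def I_def[symmetric] J_def[symmetric] scaleR_right_diff_distrib[symmetric]
    by (simp add: h_def)
  finally show ?thesis .
qed

lemma superreflexive_sum_gain:
  assumes super: "superreflexive TYPE('a::banach)" and C: "0 < C"
  obtains n where "\<And>u :: nat \<Rightarrow> 'a. dominating C u \<Longrightarrow> (\<And>i. norm (u i) \<le> 1) \<Longrightarrow>
    norm (\<Sum>i<2 ^ Suc n. u i) \<le> 2 ^ Suc n - 1 / 2"
proof (rule ccontr)
  assume contra: "\<not> thesis"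
  have "\<forall>n. \<exists>u :: nat \<Rightarrow> 'a. dominating C u \<and> (\<forall>i. norm (u i) \<le> 1) \<and>
    2 ^ Suc n - 1 / 2 < norm (\<Sum>i<2 ^ Suc n. u i)"
  proof (rule allI, rule ccontr)
    fix n
    assume *: "\<not> (\<exists>u :: nat \<Rightarrow> 'a. dominating C u \<and> (\<forall>i. norm (u i) \<le> 1) \<and>
      2 ^ Suc n - 1 / 2 < norm (\<Sum>i<2 ^ Suc n. u i))"
    have thesis
    proof (rule that[of n], rule ccontr)
      fix u :: "nat \<Rightarrow> 'a"
      assume "dominating C u" "\<And>i. norm (u i) \<le> 1" "\<not> norm (\<Sum>i<2 ^ Suc n. u i) \<le> 2 ^ Suc n - 1 / 2"
      then have "\<exists>u :: nat \<Rightarrow> 'a. dominating C u \<and> (\<forall>i. norm (u i) \<le> 1) \<and>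
          2 ^ Suc n - 1 / 2 < norm (\<Sum>i<2 ^ Suc n. u i)"
        by (intro exI[of _ u]) (simp only: not_le simp_thms)
      with * show False by contradiction
    qed
    with contra show False by contradiction
  qed
  from choice[OF this] obtain u :: "nat \<Rightarrow> nat \<Rightarrow> 'a"
    where "\<forall>n. dominating C (u n) \<and> (\<forall>i. norm (u n i) \<le> 1) \<and>
      2 ^ Suc n - 1 / 2 < norm (\<Sum>i<2 ^ Suc n. u n i)" ..
  then have u: "\<And>n. dominating C (u n)" "\<And>n i. norm (u n i) \<le> 1"
    "\<And>n. 2 ^ Suc n - 1 / 2 < norm (\<Sum>i<2 ^ Suc n. u n i)"
    by simp_all
  \<comment> \<open>\<open>X n d i\<close> is the \<open>i\<close>-th node at depth \<open>d\<close> of the \<open>n\<close>-th tree.\<close>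
  define X where "X n d i = (if d \<le> n then dyadic_avg (u n) (Suc n - d) i else 0)" for n d i
  \<comment> \<open>Pairing lists all nodes in one sequence. The padding by 0 affects a node of
    depth \<open>d\<close> only in the finitely many trees with \<open>n < d\<close>, so it is
    invisible in the limit.\<close>
  define x where "x n m = (case prod_decode m of (d, i) \<Rightarrow> X n d i)" for n m
  have x1: "norm (x n m) \<le> 1" for n m
    by (auto simp: x_def X_def norm_dyadic_avg_le u(2) split: prod.split)
  obtain r e where r: "strict_mono r"
    and lim: "\<And>M a. (\<lambda>n. norm (\<Sum>m<M. a m *\<^sub>R x (r n) m)) \<longlonglongrightarrow> norm (\<Sum>m<M. a m *\<^sub>R (e m :: nat \<Rightarrow>\<^sub>C real))"
    by (rule limit_space[OF x1]) (rule that)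
  define V where "V = closure (span (range e))"
  have "finitely_representable V norm TYPE('a)"
    unfolding V_def by (rule finitely_representable_limit_space[OF x1 lim])
  moreover have V: "subspace V" unfolding V_def by (rule subspace_closure) (rule subspace_span)
  moreover have "banach_space_on V norm"
  proof (rule banach_space_on_complete_subspace[OF V])
    show "complete V"
      by (rule complete_closed_subset[OF _ subset_UNIV complete_UNIV_bcontfun]) (simp add: V_def)
  qed
  ultimately have refl: "reflexive_on V norm"
    using super[unfolded superreflexive_def, rule_format, of V norm] by simp
  define E where "E d i = e (prod_encode (d, i))" for d i
  \<comment> \<open>Midpoint identities and sibling distances are norms of combinations of at most
    three nodes, so this case transfers both to the limit tree.\<close>
  have lim3: "(\<lambda>n. norm (\<alpha> *\<^sub>R X (r n) d i + \<beta> *\<^sub>R X (r n) d' i' + \<gamma> *\<^sub>R X (r n) d'' i''))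
    \<longlonglongrightarrow> norm (\<alpha> *\<^sub>R E d i + \<beta> *\<^sub>R E d' i' + \<gamma> *\<^sub>R E d'' i'')" for \<alpha> \<beta> \<gamma> d i d' i' d'' i''
  proof -
    define t p q where "t = prod_encode (d, i)" and "p = prod_encode (d', i')"
      and "q = prod_encode (d'', i'')"
    define M where "M = Suc (t + p + q)"
    have M: "t < M" "p < M" "q < M" by (auto simp: M_def)
    \<comment> \<open>A sum of indicators, since the three nodes may coincide.\<close>
    define a where "a m = (if m = t then \<alpha> else 0) + (if m = p then \<beta> else 0) + (if m = q then \<gamma> else 0)" for m
    have pick: "(\<Sum>m<M. (if m = k then \<rho> else 0) *\<^sub>R v m) = \<rho> *\<^sub>R v k" if "k < M"
      for k \<rho> and v :: "nat \<Rightarrow> 'c::real_vector"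
    proof -
      have "(\<Sum>m<M. (if m = k then \<rho> else 0) *\<^sub>R v m) = (\<Sum>m<M. if m = k then \<rho> *\<^sub>R v m else 0)"
        by (rule sum.cong) auto
      then show ?thesis using that by simp
    qed
    have a: "(\<Sum>m<M. a m *\<^sub>R v m) = \<alpha> *\<^sub>R v t + \<beta> *\<^sub>R v p + \<gamma> *\<^sub>R v q" for v :: "nat \<Rightarrow> 'c::real_vector"
      by (simp add: a_def scaleR_left_distrib sum.distrib pick M)
    show ?thesis
      using lim[where a = a and M = M] unfolding a by (simp add: x_def E_def t_def p_def q_def)
  qed
  have e1: "norm (e m) \<le> 1" for m
  proof -
    obtain d i where m: "m = prod_encode (d, i)" by (metis prod_decode_inverse surj_pair)
    have "norm (X (r n) d i) \<le> 1" for n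
      by (simp add: X_def norm_dyadic_avg_le u(2))
    then have "norm (E d i) \<le> 1"
      using LIMSEQ_le_const2[OF lim3[where \<alpha> = 1 and \<beta> = 0 and \<gamma> = 0 and d = d and i = i]] by simp
    then show ?thesis by (simp add: E_def m)
  qed
  obtain y :: "nat \<Rightarrow> nat \<Rightarrow>\<^sub>C real" where y: "\<And>v \<eta>. v \<in> V \<Longrightarrow> 0 < \<eta> \<Longrightarrow> \<exists>k. norm (v - y k) < \<eta>"
    by (rule countable_dense_closure_span[where e = e, OF e1, folded V_def]) (rule that)
  \<comment> \<open>For \<open>i < 2 ^ d\<close> the blocks behind node \<open>i\<close> lie within
    the first \<open>2 ^ Suc n\<close> terms, to which the lower bound on the norm refers.\<close>
  define T where "T = {E d i |d i. i < 2 ^ d}"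
  show False
  proof (rule reflexive_on_no_midpoint_bush[OF V refl y, where T = T and \<epsilon> = "1 / (2 * C)"])
    show "T \<subseteq> V"
      using closure_subset[of "span (range e)"] span_base[of _ "range e"]
      by (fastforce simp: T_def V_def E_def)
    have "E 0 0 \<in> T" unfolding T_def by force
    then show "T \<noteq> {}" by blast
    show "norm t \<le> 1" if "t \<in> T" for t
      using that e1 by (auto simp: T_def E_def)
    show "0 < 1 / (2 * C)" using C by simp
    fix t assume "t \<in> T"
    then obtain d i where t: "t = E d i" "i < 2 ^ d" by (auto simp: T_def)
    define p q where "p = E (Suc d) (2 * i)" and "q = E (Suc d) (Suc (2 * i))"
    have "p \<in> T" "q \<in> T" using t(2) unfolding T_def p_def q_def by fastforce+
    have large: "\<forall>\<^sub>F n in sequentially. Suc d \<le> r n"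
      using r by (meson eventually_at_top_linorder order_trans seq_suble)
    have half: "X (r n) d i = (1 / 2) *\<^sub>R (X (r n) (Suc d) (2 * i) + X (r n) (Suc d) (Suc (2 * i)))"
      if "Suc d \<le> r n" for n
    proof -
      have "Suc (r n) - d = Suc (Suc (r n) - Suc d)" using that by simp
      then show ?thesis using that dyadic_avg_Suc by (simp add: X_def)
    qed
    \<comment> \<open>The midpoint identity passes to the limit as the vanishing of a norm, since
      only norms of combinations are known to converge.\<close>
    have "(\<lambda>n. norm (1 *\<^sub>R X (r n) d i + (- 1 / 2) *\<^sub>R X (r n) (Suc d) (2 * i)
        + (- 1 / 2) *\<^sub>R X (r n) (Suc d) (Suc (2 * i)))) \<longlonglongrightarrow> 0"
      by (rule tendsto_eventually, rule eventually_mono[OF large])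
        (simp add: half scaleR_right_distrib)
    then have "norm (1 *\<^sub>R t + (- 1 / 2) *\<^sub>R p + (- 1 / 2) *\<^sub>R q) = 0"
      unfolding t p_def q_def by (rule LIMSEQ_unique[OF lim3])
    then have "t = (1 / 2) *\<^sub>R (p + q)" by (simp add: scaleR_right_distrib algebra_simps)
    moreover have "1 / (2 * C) \<le> norm (p - q)"
    proof -
      have sep: "1 / (2 * C) \<le> norm (X (r n) (Suc d) (2 * i) - X (r n) (Suc d) (Suc (2 * i)))"
        if "Suc d \<le> r n" for n
      proof -
        have "Suc (2 * i) * 2 ^ (Suc (r n) - Suc d) \<le> 2 ^ Suc d * 2 ^ (Suc (r n) - Suc d)"
          using t(2) by (intro mult_right_mono) auto
        also have "\<dots> = 2 ^ Suc (r n)" using that by (subst power_add[symmetric]) simp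
        finally have "1 / (2 * C) \<le> norm (dyadic_avg (u (r n)) (Suc (r n) - Suc d) (2 * i)
            - dyadic_avg (u (r n)) (Suc (r n) - Suc d) (Suc (2 * i)))"
          using u(3)[of "r n"] by (intro dyadic_avg_separated[OF u(1,2) C, where N = "2 ^ Suc (r n)"]) auto
        then show ?thesis using that by (simp add: X_def)
      qed
      have "(\<lambda>n. norm (1 *\<^sub>R X (r n) (Suc d) (2 * i) + (- 1) *\<^sub>R X (r n) (Suc d) (Suc (2 * i)) + 0 *\<^sub>R X (r n) 0 0))
        \<longlonglongrightarrow> norm (1 *\<^sub>R p + (- 1) *\<^sub>R q + 0 *\<^sub>R E 0 0)"
        unfolding p_def q_def by (rule lim3)
      then have "(\<lambda>n. norm (X (r n) (Suc d) (2 * i) - X (r n) (Suc d) (Suc (2 * i)))) \<longlonglongrightarrow> norm (p - q)"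
        by simp
      then show ?thesis
        by (rule tendsto_lowerbound) (use large sep in \<open>auto elim: eventually_mono\<close>)
    qed
    ultimately show "\<exists>p\<in>T. \<exists>q\<in>T. t = (1 / 2) *\<^sub>R (p + q) \<and> 1 / (2 * C) \<le> norm (p - q)"
      using \<open>p \<in> T\<close> \<open>q \<in> T\<close> by blast
  qed
qed

theorem theorem2p3:
  assumes "superreflexive TYPE('a::banach)"
  shows "\<forall>C::real. C > 0 \<longrightarrow> (\<exists>K q :: real. K > 0 \<and> q > 1 \<and>
    (\<forall>f :: nat \<Rightarrow> 'a.
       summable (\<lambda>n. norm (f (Suc n)) powr q) \<and>
       (\<forall>j k m. 1 \<le> j \<and> j \<le> k \<and> k \<le> m \<longrightarrow>
          norm (\<Sum>n=j..k. f n) \<le> C * norm ((\<Sum>n=j..k. f n) - (\<Sum>n=k+1..m. f n))) \<longrightarrow>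
       summable (\<lambda>n. f (Suc n)) \<and>
       norm (\<Sum>n. f (Suc n)) \<le> K * (\<Sum>n. norm (f (Suc n)) powr q) powr (1 / q)))"
proof (intro allI impI)
  fix C :: real assume C: "C > 0"
  obtain n where gain: "\<And>u :: nat \<Rightarrow> 'a. dominating C u \<Longrightarrow> (\<And>i. norm (u i) \<le> 1) \<Longrightarrow>
    norm (\<Sum>i<2 ^ Suc n. u i) \<le> 2 ^ Suc n - 1 / 2"
    using superreflexive_sum_gain[OF assms C] by blast
  define N :: nat where "N = 2 ^ Suc n"
  define A where "A = real N - 1 / 2"
  have N: "2 \<le> N" by (simp add: N_def)
  have A: "0 < A" "A < real N" using N by (auto simp: A_def)
  have flat: "norm (\<Sum>i<N. u i) \<le> A" if "dominating C u" "\<And>i. norm (u i) \<le> 1" for u :: "nat \<Rightarrow> 'a"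
    using gain[OF that] by (simp add: N_def A_def)
  obtain q where q: "q > 1" "A * real N powr (- 1 / q) < 1"
    by (rule powr_exponent_slack[OF A]) (use N in auto)
  define K where "K = A / (1 - A * real N powr (- 1 / q))"
  have K: "0 < K" using A q by (simp add: K_def)
  have est: "norm (\<Sum>i<L. f i) \<le> K * (\<Sum>i<L. norm (f i) powr q) powr (1 / q)"
    if "dominating C f" for f :: "nat \<Rightarrow> 'a" and L
    unfolding K_def by (rule upper_estimate_sum[OF N A(1) q flat that])
  show "\<exists>K q :: real. K > 0 \<and> q > 1 \<and>
    (\<forall>f :: nat \<Rightarrow> 'a.
       summable (\<lambda>n. norm (f (Suc n)) powr q) \<and>
       (\<forall>j k m. 1 \<le> j \<and> j \<le> k \<and> k \<le> m \<longrightarrow>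
          norm (\<Sum>n=j..k. f n) \<le> C * norm ((\<Sum>n=j..k. f n) - (\<Sum>n=k+1..m. f n))) \<longrightarrow>
       summable (\<lambda>n. f (Suc n)) \<and>
       norm (\<Sum>n. f (Suc n)) \<le> K * (\<Sum>n. norm (f (Suc n)) powr q) powr (1 / q))"
  proof (intro exI[of _ K] exI[of _ q] conjI allI impI, fact K, fact q(1))
    fix f :: "nat \<Rightarrow> 'a"
    assume f: "summable (\<lambda>n. norm (f (Suc n)) powr q) \<and>
       (\<forall>j k m. 1 \<le> j \<and> j \<le> k \<and> k \<le> m \<longrightarrow>
          norm (\<Sum>n=j..k. f n) \<le> C * norm ((\<Sum>n=j..k. f n) - (\<Sum>n=k+1..m. f n)))"
    have "dominating C (\<lambda>n. f (Suc n))"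
      unfolding dominating_def
    proof (intro allI impI)
      fix a b c :: nat assume abc: "a \<le> b \<and> b \<le> c"
      have sh: "(\<Sum>n=a..<b. f (Suc n)) = (\<Sum>n=a+1..b. f n)" for a b
        using sum.shift_bounds_Suc_ivl[of f a b] by (simp add: atLeastLessThanSuc_atLeastAtMost)
      show "norm (\<Sum>n=a..<b. f (Suc n)) \<le> C * norm ((\<Sum>n=a..<b. f (Suc n)) - (\<Sum>n=b..<c. f (Suc n)))"
      \<comment> \<open>The given inequality corresponds to \<open>j = a + 1\<close>,
        \<open>k = b\<close>, \<open>m = c\<close> and covers \<open>a < b\<close>; the empty block
        is treated separately, using \<open>C > 0\<close>.\<close>
      proof (cases "a = b")
        case True
        then show ?thesis using C by simp
      next
        case False
        then show ?thesis unfolding sh using f abc by simp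
      qed
    qed
    from upper_estimate_series[OF K q(1) est this] f
    show "summable (\<lambda>n. f (Suc n))"
      and "norm (\<Sum>n. f (Suc n)) \<le> K * (\<Sum>n. norm (f (Suc n)) powr q) powr (1 / q)"
      by auto
  qed
qed

end
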